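(* Let $d\ge 1$ and let $(\{W(x)\}_{x\in\mathbb{R}^d},Q)$ be a real-valued continuous centered Gaussian process indexed by $\mathbb{R}^d$ satisfying the Gaussian environment assumption (stated in the context) with function $\gamma:\mathbb{R}^d\to[0,\infty)$. Let $\mu^W(\mathrm{d}x)=e^{-W(x)}\,\mathrm{d}x$ and $B(0,R)=\{y\in\mathbb{R}^d:|y|\le R\}$. Then: (1) $\lim_{R\to\infty}\mu^W(B(0,R))=\infty$, $Q$-almost surely. (2) If $\limsup_{|x|\to\infty}\dfrac{\gamma(x)\sqrt{\log\log|x|}}{|x|}<\infty$, then $$\limsup_{R\to\infty}\frac1R\log\big(\mu^W(B(0,R))\big)<\infty,\quad Q\text{-almost surely}.$$ (3) If $\limsup_{|x|\to\infty}\dfrac{\gamma(x)\sqrt{\log\log|x|}}{|x|^p}=0$ for some $p\in(0,1)$, then $$\lim_{R\to\infty}\frac1R\log\big(\mu^W(B(0,R))\big)=0,\quad Q\text{-almost surely}.$$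
   Context: **Gaussian environment assumption.** $E$ denotes expectation with respect to $Q$. (1) There is a function $\gamma:\mathbb{R}^d\to[0,\infty)$ with $\gamma(0)=0$, $\gamma(x)>0$ for $x\neq0$, and $E[(W(x)-W(y))^2]=\gamma(x-y)^2$ for all $x,y\in\mathbb{R}^d$. Moreover, there exist nondecreasing functions $\sigma_i:[0,\infty)\to[0,\infty)$, $1\le i\le l$, and positive integers $d_1,\dots,d_l$ with $d_1+\cdots+d_l=d$, such that $\gamma(x)^2=\sum_{i=1}^l\sigma_i(|x_i|)^2$ for $x=(x_1,\dots,x_l)\in\mathbb{R}^{d_1}\times\cdots\times\mathbb{R}^{d_l}$. (2) (a) $\lim_{|x|\to\infty}\gamma(x)\sqrt{\log\log|x|}/\log|x|=\infty$. (b) Every $\sigma_i$ is nondecreasing and continuously differentiable on $(0,\infty)$, and there exist constants $\alpha_i\in(0,1)$ and $\beta_i\in(0,1)$ such that $\sigma_i$ is regularly varying at $0$ with rate (index) $\alpha_i$ and at $\infty$ with rate (index) $\beta_i$. (c) There is a constant $c_0>0$ such that for every $1\le i\le l$, $x|\sigma_i'(x)|\le c_0\sigma_i(x)$ for all $x>0$. *)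

theory Defs
  imports "HOL-Probability.Probability"
begin

text \<open>The constant \<open>0\<close> counts as a centered Gaussian random variable, since
  \<open>normal_density\<close> is a density only for positive standard deviation.\<close>

definition centered_gaussian :: "'w measure \<Rightarrow> ('w \<Rightarrow> real) \<Rightarrow> bool" where
  "centered_gaussian Q X \<longleftrightarrow>
     X \<in> borel_measurable Q \<and>
     ((AE \<omega> in Q. X \<omega> = 0) \<or> (\<exists>s>0. distributed Q lborel X (normal_density 0 s)))"

definition centered_gaussian_process :: "'w measure \<Rightarrow> ('i \<Rightarrow> 'w \<Rightarrow> real) \<Rightarrow> bool" where
  "centered_gaussian_process Q W \<longleftrightarrow>
     prob_space Q \<and>
     (\<forall>S c. finite S \<longrightarrow> centered_gaussian Q (\<lambda>\<omega>. \<Sum>x\<in>S. c x * W x \<omega>))"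

definition regularly_varying_at_infinity :: "(real \<Rightarrow> real) \<Rightarrow> real \<Rightarrow> bool" where
  "regularly_varying_at_infinity f \<rho> \<longleftrightarrow>
     (\<forall>\<^sub>F t in at_top. 0 < f t) \<and>
     (\<forall>a>0. ((\<lambda>t. f (a * t) / f t) \<longlongrightarrow> a powr \<rho>) at_top)"

definition regularly_varying_at_zero :: "(real \<Rightarrow> real) \<Rightarrow> real \<Rightarrow> bool" where
  "regularly_varying_at_zero f \<rho> \<longleftrightarrow>
     (\<forall>\<^sub>F t in at_right 0. 0 < f t) \<and>
     (\<forall>a>0. ((\<lambda>t. f (a * t) / f t) \<longlongrightarrow> a powr \<rho>) (at_right 0))"

text \<open>The splitting \<open>x = (x\<^sub>1, \<dots>, x\<^sub>l)\<close> of a vector into blocks of dimensions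
  \<open>dims 1, \<dots>, dims l\<close> is given by a map \<open>blk\<close> sending each coordinate index to the number
  of its block.  Since the index type carries no order, which coordinates form the \<open>i\<close>-th block
  is part of the data.\<close>

definition block_decomposition :: "nat \<Rightarrow> (nat \<Rightarrow> nat) \<Rightarrow> ('n::finite \<Rightarrow> nat) \<Rightarrow> bool" where
  "block_decomposition l dims blk \<longleftrightarrow>
     (\<forall>j. blk j \<in> {1..l}) \<and>
     (\<forall>i\<in>{1..l}. 0 < dims i \<and> card {j. blk j = i} = dims i) \<and>
     (\<Sum>i=1..l. dims i) = CARD('n)"

definition block_norm :: "('n::finite \<Rightarrow> nat) \<Rightarrow> nat \<Rightarrow> real ^ 'n \<Rightarrow> real" where
  "block_norm blk i x = L2_set (\<lambda>j. x $ j) {j. blk j = i}"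

text \<open>Functions on \<open>[0, \<infinity>)\<close> are rendered as functions on \<open>real\<close>
  whose values at negative arguments are irrelevant.\<close>

definition gaussian_environment ::
    "'w measure \<Rightarrow> (real ^ 'n::finite \<Rightarrow> 'w \<Rightarrow> real) \<Rightarrow> (real ^ 'n \<Rightarrow> real) \<Rightarrow> bool" where
  "gaussian_environment Q W \<gamma> \<longleftrightarrow>
     \<gamma> 0 = 0 \<and> (\<forall>x. x \<noteq> 0 \<longrightarrow> 0 < \<gamma> x) \<and>
     (\<forall>x y. (LINT \<omega>|Q. (W x \<omega> - W y \<omega>)\<^sup>2) = (\<gamma> (x - y))\<^sup>2) \<and>
     (LIM x at_infinity. \<gamma> x * sqrt (ln (ln (norm x))) / ln (norm x) :> at_top) \<and>
     (\<exists>l dims blk \<sigma>.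
        block_decomposition l dims blk \<and>
        (\<forall>i\<in>{1..l}. (\<forall>t\<ge>0. 0 \<le> \<sigma> i t) \<and> mono_on {0..} (\<sigma> i)) \<and>
        (\<forall>x. (\<gamma> x)\<^sup>2 = (\<Sum>i=1..l. (\<sigma> i (block_norm blk i x))\<^sup>2)) \<and>
        (\<forall>i\<in>{1..l}. \<sigma> i differentiable_on {0<..} \<and> continuous_on {0<..} (deriv (\<sigma> i)) \<and>
           (\<exists>\<alpha>\<in>{0<..<1}. regularly_varying_at_zero (\<sigma> i) \<alpha>) \<and>
           (\<exists>\<beta>\<in>{0<..<1}. regularly_varying_at_infinity (\<sigma> i) \<beta>)) \<and>
        (\<exists>c\<^sub>0>0. \<forall>i\<in>{1..l}. \<forall>t>0. t * \<bar>deriv (\<sigma> i) t\<bar> \<le> c\<^sub>0 * \<sigma> i t))"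

definition random_measure :: "(real ^ 'n::finite \<Rightarrow> 'w \<Rightarrow> real) \<Rightarrow> 'w \<Rightarrow> (real ^ 'n) measure" where
  "random_measure W \<omega> = density lborel (\<lambda>x. ennreal (exp (- W x \<omega>)))"

text \<open>\<open>log_mass W \<omega> R\<close> is \<open>log \<mu>\<^sup>W(B(0,R))\<close>; it is extended-real valued so that an
  infinite mass would have logarithm \<open>\<infinity>\<close> and mass zero logarithm \<open>-\<infinity>\<close>.\<close>

definition log_mass :: "(real ^ 'n::finite \<Rightarrow> 'w \<Rightarrow> real) \<Rightarrow> 'w \<Rightarrow> real \<Rightarrow> ereal" where
  "log_mass W \<omega> R =
     (let m = emeasure (random_measure W \<omega>) (cball 0 R)
      in if m = \<infinity> then \<infinity> else if m = 0 then -\<infinity> else ereal (ln (enn2real m)))"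

end

theory Submission
  imports Defs "HOL-Real_Asymp.Real_Asymp"
begin

text \<open>The mass is compared with the values of the field at single points, by covering space with unit
  cubes with corner \<open>z\<close>.  On one cube the field differs from its corner value only by increments over
  distances at most the dimension; their variances are bounded uniformly in \<open>z\<close>, so that by Tonelli's theorem
  and the Gaussian exponential moments the integrals \<open>\<integral> exp (\<plusminus>(W y - W z)) dy\<close> over the cube have
  expectations bounded uniformly in \<open>z\<close> (lemma \<open>cell_oscillation_moment\<close>).  No maximal inequality
  is involved, and only the corner values \<open>W z\<close> have to be controlled.

  \<^emph>\<open>Infinite total mass.\<close>  Along a coordinate axis \<open>\<gamma>\<close> is one of the functions \<open>\<sigma>\<^sub>i\<close>; it tends
  to infinity but grows sublinearly, and the bound on the derivative keeps its increments over a fixed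
  distance of the order \<open>\<gamma> (t e) / t\<close>.  If \<open>s\<close> stays fixed and \<open>t\<close> tends to infinity, the correlation of
  \<open>W (s e) - W 0\<close> and \<open>W (t e) - W 0\<close> therefore tends to zero
  (lemma \<open>increment_correlation_tends_to_0\<close>).  So there are
  points \<open>x k\<close> on the axis, as sparse as one likes, at which the normalised increments
  \<open>Y k = (W (x k) - W 0) / \<gamma> (x k)\<close> are almost orthogonal Gaussians.  A law of large numbers for
  \<open>exp (-2 * Y k)\<close>, whose mean \<open>exp 2\<close> exceeds \<open>exp 1\<close>, forces \<open>Y k < -1/2\<close> infinitely often, almost surely
  (lemma \<open>nearly_orthogonal_gaussians_below_infinitely_often\<close>).  At these \<open>k\<close> the field has value below
  \<open>W 0 - \<gamma> (x k) / 2\<close>; the drop dominates the oscillation over the cube at \<open>x k\<close>, and the masses of these cubes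
  are unbounded (lemma \<open>cell_masses_unbounded\<close>).

  \<^emph>\<open>Subexponential growth.\<close>  Regular variation at infinity with index below one gives
  \<open>\<gamma> x \<le> C * r powr q\<close> whenever \<open>norm x \<le> r\<close> and \<open>r \<ge> 1\<close>, with some \<open>q < 1\<close>.  A union
  bound over the polynomially many lattice points with coordinates between \<open>- n\<close> and \<open>n\<close> and the Borel-Cantelli lemma show that, almost surely for all large
  \<open>n\<close>, neither a factor \<open>exp (W 0 - W z)\<close> nor a cube integral at these points exceeds
  \<open>exp (n powr ((1 + q) / 2))\<close> (lemma \<open>mass_of_ball_le_exp_powr\<close>).  Since \<open>(1 + q) / 2 < 1\<close>, the
  logarithm of the mass is \<open>o(R)\<close>; it is eventually positive because the mass tends to infinity.  So the
  logarithm divided by \<open>R\<close> tends to zero, and in particular its upper limit is finite.\<close>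

section \<open>Centered Gaussian variables and processes\<close>

lemma centered_gaussian_exp_moment:
  assumes "prob_space Q" and X: "centered_gaussian Q X"
  shows "integrable Q (\<lambda>\<omega>. (X \<omega>)\<^sup>2)"
    and "integrable Q (\<lambda>\<omega>. exp (a * X \<omega>))"
    and "(LINT \<omega>|Q. exp (a * X \<omega>)) = exp (a\<^sup>2 * (LINT \<omega>|Q. (X \<omega>)\<^sup>2) / 2)"
proof -
  interpret prob_space Q by fact
  have meas [measurable]: "X \<in> borel_measurable Q"
    using X by (simp add: centered_gaussian_def)
  have "integrable Q (\<lambda>\<omega>. (X \<omega>)\<^sup>2) \<and> integrable Q (\<lambda>\<omega>. exp (a * X \<omega>)) \<and>
      (LINT \<omega>|Q. exp (a * X \<omega>)) = exp (a\<^sup>2 * (LINT \<omega>|Q. (X \<omega>)\<^sup>2) / 2)"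
  proof (cases "AE \<omega> in Q. X \<omega> = 0")
    case True
    have "integrable Q (\<lambda>\<omega>. (X \<omega>)\<^sup>2) \<longleftrightarrow> integrable Q (\<lambda>\<omega>. 0 :: real)"
      using True by (intro integrable_cong_AE) auto
    moreover have "integrable Q (\<lambda>\<omega>. exp (a * X \<omega>)) \<longleftrightarrow> integrable Q (\<lambda>\<omega>. 1 :: real)"
      using True by (intro integrable_cong_AE) auto
    moreover have "(LINT \<omega>|Q. (X \<omega>)\<^sup>2) = (LINT \<omega>|Q. 0 :: real)"
      using True by (intro integral_cong_AE) auto
    moreover have "(LINT \<omega>|Q. exp (a * X \<omega>)) = (LINT \<omega>|Q. 1 :: real)"
      using True by (intro integral_cong_AE) auto
    ultimately show ?thesis by (simp add: prob_space)
  next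
    case False
    then obtain s where s: "s > 0" and D: "distributed Q lborel X (normal_density 0 s)"
      using X by (auto simp: centered_gaussian_def)
    have sq: "integrable Q (\<lambda>\<omega>. (X \<omega>)\<^sup>2)"
      using distributed_integrable[OF D, of "\<lambda>x. x\<^sup>2"] integrable_normal_moment[OF s, of 0 2] by simp
    have var: "(LINT \<omega>|Q. (X \<omega>)\<^sup>2) = s\<^sup>2"
      using normal_distributed_variance[OF s D] normal_distributed_expectation[OF s D] by simp
    \<comment> \<open>Completing the square: tilting by the exponential moves the mean to \<open>a * s\<^sup>2\<close>.\<close>
    have tilt: "normal_density 0 s x * exp (a * x) = exp (a\<^sup>2 * s\<^sup>2 / 2) * normal_density (a * s\<^sup>2) s x"
      for x
    proof -
      have "- x\<^sup>2 / (2 * s\<^sup>2) + a * x = a\<^sup>2 * s\<^sup>2 / 2 + (- (x - a * s\<^sup>2)\<^sup>2 / (2 * s\<^sup>2))"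
        using s by (simp add: field_simps power2_eq_square)
      then show ?thesis
        unfolding normal_density_def by (simp add: exp_add[symmetric] field_simps)
    qed
    have "integrable Q (\<lambda>\<omega>. exp (a * X \<omega>))"
      using distributed_integrable[OF D, of "\<lambda>x. exp (a * x)"] s by (simp add: tilt)
    moreover have "(LINT \<omega>|Q. exp (a * X \<omega>)) = exp (a\<^sup>2 * s\<^sup>2 / 2)"
      using distributed_integral[OF D, of "\<lambda>x. exp (a * x)", symmetric] s by (simp add: tilt)
    ultimately show ?thesis using sq by (simp add: var)
  qed
  then show "integrable Q (\<lambda>\<omega>. (X \<omega>)\<^sup>2)"
    and "integrable Q (\<lambda>\<omega>. exp (a * X \<omega>))"
    and "(LINT \<omega>|Q. exp (a * X \<omega>)) = exp (a\<^sup>2 * (LINT \<omega>|Q. (X \<omega>)\<^sup>2) / 2)"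
    by blast+
qed

lemma centered_gaussian_cong_AE:
  assumes "centered_gaussian Q X" and [measurable]: "Y \<in> borel_measurable Q"
    and eq: "AE \<omega> in Q. X \<omega> = Y \<omega>"
  shows "centered_gaussian Q Y"
proof -
  have [measurable]: "X \<in> borel_measurable Q"
    using assms(1) by (simp add: centered_gaussian_def)
  have "distr Q lborel X = distr Q lborel Y"
    using eq by (intro distr_cong_AE) auto
  moreover have "(AE \<omega> in Q. X \<omega> = 0) \<longleftrightarrow> (AE \<omega> in Q. Y \<omega> = 0)"
    using eq by (intro eventually_subst) (auto elim: eventually_mono)
  ultimately show ?thesis
    using assms(1,2) unfolding centered_gaussian_def distributed_def by simp
qed

lemma gaussian_process_linear_combination:
  assumes "centered_gaussian_process Q W" and "finite S"
  shows "centered_gaussian Q (\<lambda>\<omega>. \<Sum>x\<in>S. c x * W x \<omega>)"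
proof -
  have "\<forall>S c. finite S \<longrightarrow> centered_gaussian Q (\<lambda>\<omega>. \<Sum>x\<in>S. c x * W x \<omega>)"
    using assms(1) unfolding centered_gaussian_process_def by (rule conjunct2)
  then show ?thesis
    using assms(2) by (elim allE impE)
qed

lemma gaussian_process_two_increments:
  assumes "centered_gaussian_process Q W"
  shows "centered_gaussian Q (\<lambda>\<omega>. a * (W x \<omega> - W z \<omega>) + b * (W y \<omega> - W z \<omega>))"
proof -
  define c where "c u = (if u = x then a else 0) + (if u = y then b else 0)
      - (if u = z then a + b else 0)" for u
  have "centered_gaussian Q (\<lambda>\<omega>. \<Sum>u\<in>{x, y, z}. c u * W u \<omega>)"
    by (rule gaussian_process_linear_combination[OF assms]) simp
  also have "(\<lambda>\<omega>. \<Sum>u\<in>{x, y, z}. c u * W u \<omega>) =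
      (\<lambda>\<omega>. a * (W x \<omega> - W z \<omega>) + b * (W y \<omega> - W z \<omega>))"
  proof
    fix \<omega>
    have "c u * W u \<omega> = (if u = x then a * W x \<omega> else 0) + (if u = y then b * W y \<omega> else 0)
        - (if u = z then (a + b) * W z \<omega> else 0)" for u
      by (auto simp: c_def algebra_simps)
    then have "(\<Sum>u\<in>{x, y, z}. c u * W u \<omega>) =
        (\<Sum>u\<in>{x, y, z}. if u = x then a * W x \<omega> else 0)
        + (\<Sum>u\<in>{x, y, z}. if u = y then b * W y \<omega> else 0)
        - (\<Sum>u\<in>{x, y, z}. if u = z then (a + b) * W z \<omega> else 0)"
      by (simp only: sum.distrib sum_subtractf)
    also have "\<dots> = a * W x \<omega> + b * W y \<omega> - (a + b) * W z \<omega>"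
      by (subst (1 2 3) sum.delta) auto
    also have "\<dots> = a * (W x \<omega> - W z \<omega>) + b * (W y \<omega> - W z \<omega>)"
      by (simp add: algebra_simps)
    finally show "(\<Sum>u\<in>{x, y, z}. c u * W u \<omega>) = a * (W x \<omega> - W z \<omega>) + b * (W y \<omega> - W z \<omega>)" .
  qed
  finally show ?thesis .
qed

lemma gaussian_process_increment:
  assumes "centered_gaussian_process Q W"
  shows "centered_gaussian Q (\<lambda>\<omega>. a * (W x \<omega> - W y \<omega>))"
  using gaussian_process_two_increments[OF assms, of a x y 0 x] by simp

text \<open>Changing the process on a null set makes every path continuous, which is what joint measurability
  in space and chance, and hence Tonelli's theorem, require.\<close>

lemma gaussian_process_continuous_version:
  fixes W :: "real ^ 'n \<Rightarrow> 'w \<Rightarrow> real"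
  assumes gauss: "centered_gaussian_process Q W"
    and cont: "AE \<omega> in Q. continuous_on UNIV (\<lambda>x. W x \<omega>)"
  obtains V where "centered_gaussian_process Q V"
    and "\<forall>\<omega>. continuous_on UNIV (\<lambda>x. V x \<omega>)"
    and "AE \<omega> in Q. \<forall>x. V x \<omega> = W x \<omega>"
proof -
  obtain N where N: "N \<in> null_sets Q"
    and sub: "{\<omega> \<in> space Q. \<not> continuous_on UNIV (\<lambda>x. W x \<omega>)} \<subseteq> N"
    using cont by (auto elim!: AE_E simp: null_sets_def)
  define V where "V x \<omega> = (if \<omega> \<in> space Q - N then W x \<omega> else 0)" for x \<omega>
  have eq: "AE \<omega> in Q. \<forall>x. V x \<omega> = W x \<omega>"
    using AE_not_in[OF N] AE_space by eventually_elim (auto simp: V_def)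
  have [measurable]: "N \<in> sets Q" using N by auto
  have W: "centered_gaussian Q (\<lambda>\<omega>. \<Sum>x\<in>S. c x * W x \<omega>)" if "finite S" for S c
    by (rule gaussian_process_linear_combination[OF gauss that])
  have [measurable]: "W x \<in> borel_measurable Q" for x
    using W[of "{x}" "\<lambda>_. 1"] by (simp add: centered_gaussian_def)
  have [measurable]: "V x \<in> borel_measurable Q" for x
  proof -
    have "(\<lambda>\<omega>. if \<omega> \<in> N then 0 else W x \<omega>) \<in> borel_measurable Q" by measurable
    then show ?thesis
      by (rule measurable_cong[THEN iffD1, rotated]) (auto simp: V_def)
  qed
  show thesis
  proof
    show "AE \<omega> in Q. \<forall>x. V x \<omega> = W x \<omega>" by (fact eq)
    show "\<forall>\<omega>. continuous_on UNIV (\<lambda>x. V x \<omega>)"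
    proof
      show "continuous_on UNIV (\<lambda>x. V x \<omega>)" for \<omega>
        using sub by (cases "\<omega> \<in> space Q - N") (auto simp: V_def)
    qed
    have "centered_gaussian Q (\<lambda>\<omega>. \<Sum>x\<in>S. c x * V x \<omega>)" if "finite S" for S c
      using W[OF that, of c] by (rule centered_gaussian_cong_AE) (use eq in auto)
    then show "centered_gaussian_process Q V"
      using gauss by (simp add: centered_gaussian_process_def)
  qed
qed

text \<open>If \<open>Y k \<ge> -1/2\<close> held for all \<open>k \<ge> n\<close>, every average of \<open>exp (-2 * Y k)\<close> over a block starting at
  \<open>n\<close> would be at most \<open>exp 1\<close>.  But this variable has mean \<open>exp (2\<^sup>2 / 2) = exp 2\<close>, and the covariances are
  explicit functions of those of the \<open>Y k\<close>, small enough for the averages to concentrate at their mean.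
  Exponentials are used since their joint moments need no more than the variances of the linear combinations.\<close>

lemma nearly_orthogonal_gaussians_below_infinitely_often:
  fixes Y :: "nat \<Rightarrow> 'w \<Rightarrow> real"
  assumes "prob_space Q"
    and gauss: "\<And>j k a b. centered_gaussian Q (\<lambda>\<omega>. a * Y j \<omega> + b * Y k \<omega>)"
    and unit: "\<And>k. (LINT \<omega>|Q. (Y k \<omega>)\<^sup>2) = 1"
    and cov: "\<And>j k. j < k \<Longrightarrow> (LINT \<omega>|Q. Y j \<omega> * Y k \<omega>) \<le> (1 / 4) ^ k"
  shows "AE \<omega> in Q. \<exists>\<^sub>\<infinity>k. Y k \<omega> < - 1 / 2"
proof -
  interpret prob_space Q by fact
  have one: "centered_gaussian Q (\<lambda>\<omega>. a * Y k \<omega>)" for a k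
    using gauss[of a k 0 k] by simp
  have [measurable]: "Y k \<in> borel_measurable Q" for k
    using one[of 1 k] by (simp add: centered_gaussian_def)
  have sq: "integrable Q (\<lambda>\<omega>. (a * Y j \<omega> + b * Y k \<omega>)\<^sup>2)" for a b j k
    by (rule centered_gaussian_exp_moment(1)[OF \<open>prob_space Q\<close> gauss])
  have sq1: "integrable Q (\<lambda>\<omega>. (Y k \<omega>)\<^sup>2)" for k
    using sq[of 1 k 0 k] by simp
  have prod: "integrable Q (\<lambda>\<omega>. Y j \<omega> * Y k \<omega>)" for j k
  proof -
    have "integrable Q (\<lambda>\<omega>. ((1 * Y j \<omega> + 1 * Y k \<omega>)\<^sup>2 - (Y j \<omega>)\<^sup>2 - (Y k \<omega>)\<^sup>2) / 2)"
      by (intro integrable_divide Bochner_Integration.integrable_diff sq sq1)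
    then show ?thesis by (simp add: power2_eq_square algebra_simps)
  qed
  \<comment> \<open>\<open>U k\<close> is the centred version of \<open>exp (-2 * Y k)\<close>; its covariance matrix is estimated next.\<close>
  define F where "F k \<omega> = exp (- 2 * Y k \<omega>)" for k \<omega>
  define U where "U k \<omega> = F k \<omega> - exp 2" for k \<omega>
  have [measurable]: "U k \<in> borel_measurable Q" for k
    unfolding U_def F_def by measurable
  have F: "integrable Q (F k)" "(LINT \<omega>|Q. F k \<omega>) = exp 2" for k
    using centered_gaussian_exp_moment(2,3)[OF \<open>prob_space Q\<close> one[of 1 k], of "-2"] unit[of k]
    by (simp_all add: F_def[abs_def])
  have FF: "integrable Q (\<lambda>\<omega>. F j \<omega> * F k \<omega>)"
      "(LINT \<omega>|Q. F j \<omega> * F k \<omega>) = exp 4 * exp (4 * (LINT \<omega>|Q. Y j \<omega> * Y k \<omega>))" for j k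
  proof -
    note exps = centered_gaussian_exp_moment(2,3)[OF \<open>prob_space Q\<close> gauss[of 1 j 1 k], of "-2"]
    have eq: "F j \<omega> * F k \<omega> = exp (- 2 * (1 * Y j \<omega> + 1 * Y k \<omega>))" for \<omega>
      by (simp add: F_def exp_add[symmetric])
    show "integrable Q (\<lambda>\<omega>. F j \<omega> * F k \<omega>)"
      using exps(1) by (simp only: eq)
    have "(LINT \<omega>|Q. (1 * Y j \<omega> + 1 * Y k \<omega>)\<^sup>2) =
        (LINT \<omega>|Q. (Y j \<omega>)\<^sup>2 + ((Y k \<omega>)\<^sup>2 + 2 * (Y j \<omega> * Y k \<omega>)))"
      by (intro Bochner_Integration.integral_cong) (auto simp: power2_eq_square algebra_simps)
    also have "\<dots> = 2 + 2 * (LINT \<omega>|Q. Y j \<omega> * Y k \<omega>)"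
      using sq1 prod by (simp add: unit)
    finally show "(LINT \<omega>|Q. F j \<omega> * F k \<omega>) = exp 4 * exp (4 * (LINT \<omega>|Q. Y j \<omega> * Y k \<omega>))"
      using exps(2) by (simp only: eq) (simp add: exp_add[symmetric] algebra_simps)
  qed
  have UU: "U j \<omega> * U k \<omega> = F j \<omega> * F k \<omega> - exp 2 * F j \<omega> - exp 2 * F k \<omega> + exp 4" for j k \<omega>
    by (simp add: U_def algebra_simps exp_add[symmetric])
  have intUU: "integrable Q (\<lambda>\<omega>. U j \<omega> * U k \<omega>)" for j k
    unfolding UU using F FF by simp
  have EUU: "(LINT \<omega>|Q. U j \<omega> * U k \<omega>) = exp 4 * (exp (4 * (LINT \<omega>|Q. Y j \<omega> * Y k \<omega>)) - 1)"
    for j k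
  proof -
    have "(LINT \<omega>|Q. U j \<omega> * U k \<omega>) = exp 4 * exp (4 * (LINT \<omega>|Q. Y j \<omega> * Y k \<omega>))
        - exp 2 * exp 2 - exp 2 * exp 2 + exp 4"
      unfolding UU using F FF by (simp add: prob_space)
    then show ?thesis by (simp add: right_diff_distrib exp_add[symmetric])
  qed
  define K where "K = 4 * exp (8::real)"
  have small: "(LINT \<omega>|Q. U j \<omega> * U k \<omega>) \<le> K * ((1/2) ^ j * (1/2) ^ k)" if "j < k" for j k
  proof -
    let ?r = "LINT \<omega>|Q. Y j \<omega> * Y k \<omega>"
    let ?q = "(1/4::real) ^ k"
    have "exp (4 * ?r) - 1 \<le> exp (4 * ?q) - 1"
      using cov[OF that] by simp
    \<comment> \<open>\<open>exp u - 1 \<le> u * exp u\<close>, which is \<open>1 - u \<le> exp (-u)\<close> multiplied by \<open>exp u\<close>.\<close>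
    also have "\<dots> \<le> 4 * ?q * exp (4 * ?q)"
    proof -
      have "1 - 4 * ?q \<le> exp (- (4 * ?q))"
        using exp_ge_add_one_self[of "- (4 * ?q)"] by simp
      then have "(1 - 4 * ?q) * exp (4 * ?q) \<le> exp (- (4 * ?q)) * exp (4 * ?q)"
        by (intro mult_right_mono) auto
      then show ?thesis by (simp add: exp_add[symmetric] algebra_simps)
    qed
    also have "\<dots> \<le> 4 * ?q * exp 4"
      by (intro mult_left_mono) (auto simp: power_le_one)
    also have "?q \<le> (1/2) ^ j * (1/2) ^ k"
    proof -
      have "(1/4::real) ^ k = (1/2) ^ k * (1/2) ^ k"
        by (simp flip: power_mult_distrib)
      also have "\<dots> \<le> (1/2) ^ j * (1/2) ^ k"
        using that by (intro mult_right_mono power_decreasing) auto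
      finally show ?thesis .
    qed
    finally have "exp (4 * ?r) - 1 \<le> 4 * ((1/2) ^ j * (1/2) ^ k) * exp 4"
      by simp
    then have "exp 4 * (exp (4 * ?r) - 1) \<le> exp 4 * (4 * ((1/2) ^ j * (1/2) ^ k) * exp 4)"
      by (intro mult_left_mono) auto
    also have "\<dots> = K * ((1/2) ^ j * (1/2) ^ k)"
      by (simp add: K_def exp_add[symmetric])
    finally show ?thesis by (simp only: EUU)
  qed
  define D where "D = exp 4 * (exp (4::real) - 1)"
  have D: "(LINT \<omega>|Q. U k \<omega> * U k \<omega>) = D" for k
    using unit[of k] by (simp add: EUU D_def power2_eq_square)
  have D0: "D \<ge> 0" by (simp add: D_def)
  have K0: "K \<ge> 0" by (simp add: K_def)
  have cov_le: "(LINT \<omega>|Q. U j \<omega> * U k \<omega>) \<le> (if j = k then D else 0) + K * ((1/2) ^ j * (1/2) ^ k)"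
    for j k
  proof (cases j k rule: linorder_cases)
    case less then show ?thesis using small by simp
  next
    case equal then show ?thesis using D[of k] K0 by simp
  next
    case greater then show ?thesis using small[of k j] by (simp add: mult.commute)
  qed
  have geo: "(\<Sum>j=n..<n+N. (1/2::real) ^ j) \<le> 2" for n N
  proof -
    have "(\<Sum>j=n..<n+N. (1/2::real) ^ j) \<le> (\<Sum>j. (1/2::real) ^ j)"
      by (intro sum_le_suminf) auto
    then show ?thesis by (simp add: suminf_geometric)
  qed
  \<comment> \<open>The off-diagonal bound factors as \<open>(1/2)^j * (1/2)^k\<close>, so all of it together contributes only \<open>4 * K\<close>
    and the second moment grows linearly in the number of terms.\<close>
  have second_moment: "(LINT \<omega>|Q. (\<Sum>j=n..<n+N. U j \<omega>)\<^sup>2) \<le> N * D + 4 * K" for n N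
  proof -
    have "(LINT \<omega>|Q. (\<Sum>j=n..<n+N. U j \<omega>)\<^sup>2) =
        (\<Sum>j=n..<n+N. \<Sum>k=n..<n+N. LINT \<omega>|Q. U j \<omega> * U k \<omega>)"
      using intUU by (simp add: power2_eq_square sum_product)
    also have "\<dots> \<le> (\<Sum>j=n..<n+N. \<Sum>k=n..<n+N. (if j = k then D else 0) + K * ((1/2) ^ j * (1/2) ^ k))"
      by (intro sum_mono cov_le)
    also have "\<dots> = N * D + K * (\<Sum>j=n..<n+N. (1/2) ^ j) * (\<Sum>j=n..<n+N. (1/2) ^ j)"
      by (simp add: sum.distrib flip: sum_distrib_left sum_distrib_right)
    also have "\<dots> \<le> N * D + K * 2 * 2"
      using K0 by (intro add_left_mono mult_mono geo mult_nonneg_nonneg sum_nonneg) auto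
    finally show ?thesis by simp
  qed
  have "AE \<omega> in Q. \<not> (\<forall>k\<ge>n. - 1 / 2 \<le> Y k \<omega>)" for n
  proof -
    define B where "B = {\<omega> \<in> space Q. \<forall>k\<ge>n. - 1 / 2 \<le> Y k \<omega>}"
    have [measurable]: "B \<in> sets Q" unfolding B_def by measurable
    define \<delta> where "\<delta> = exp 2 - exp (1::real)"
    have \<delta>: "\<delta> > 0" by (simp add: \<delta>_def)
    \<comment> \<open>On \<open>B\<close> each \<open>U j\<close> is at most \<open>- \<delta>\<close>, so the sum of \<open>N\<close> of them has square at least \<open>(N * \<delta>)\<^sup>2\<close>.\<close>
    have "prob B \<le> (D / \<delta>\<^sup>2) / N + (4 * K / \<delta>\<^sup>2) / N\<^sup>2" if "N > 0" for N :: nat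
    proof -
      let ?S = "\<lambda>\<omega>. \<Sum>j=n..<n+N. U j \<omega>"
      have int: "integrable Q (\<lambda>\<omega>. (?S \<omega>)\<^sup>2)"
        using intUU by (simp add: power2_eq_square sum_product)
      have "(N * \<delta>)\<^sup>2 \<le> (?S \<omega>)\<^sup>2" if "\<omega> \<in> B" for \<omega>
      proof -
        have "U j \<omega> \<le> - \<delta>" if "j \<in> {n..<n+N}" for j
        proof -
          have "- 2 * Y j \<omega> \<le> 1" using \<open>\<omega> \<in> B\<close> that by (force simp: B_def)
          then show ?thesis by (simp add: U_def F_def \<delta>_def)
        qed
        then have "?S \<omega> \<le> (\<Sum>j=n..<n+N. - \<delta>)" by (rule sum_mono)
        then have "N * \<delta> \<le> - ?S \<omega>" by simp
        then have "(N * \<delta>)\<^sup>2 \<le> (- ?S \<omega>)\<^sup>2"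
          using \<delta> by (intro power_mono) auto
        then show ?thesis by simp
      qed
      then have "prob B \<le> prob {\<omega> \<in> space Q. (N * \<delta>)\<^sup>2 \<le> (?S \<omega>)\<^sup>2}"
        by (intro finite_measure_mono) (auto simp: B_def)
      also have "\<dots> \<le> (LINT \<omega>|Q. (?S \<omega>)\<^sup>2) / (N * \<delta>)\<^sup>2"
        using int \<delta> \<open>N > 0\<close> by (intro integral_Markov_inequality_measure[where A="{}"]) auto
      also have "\<dots> \<le> (N * D + 4 * K) / (N * \<delta>)\<^sup>2"
        by (intro divide_right_mono second_moment) auto
      also have "\<dots> = (D / \<delta>\<^sup>2) / N + (4 * K / \<delta>\<^sup>2) / N\<^sup>2"
        using \<delta> \<open>N > 0\<close> by (simp add: field_simps power2_eq_square)
      finally show ?thesis .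
    qed
    moreover have "(\<lambda>N::nat. (D / \<delta>\<^sup>2) / N + (4 * K / \<delta>\<^sup>2) / N\<^sup>2) \<longlonglongrightarrow> 0"
      by real_asymp
    ultimately have "prob B \<le> 0"
      by (intro tendsto_lowerbound[of _ 0 sequentially "prob B"] eventually_mono[OF eventually_gt_at_top[of 0]]) auto
    then have "B \<in> null_sets Q"
      by (auto simp: null_sets_def emeasure_eq_measure measure_le_0_iff)
    from AE_not_in[OF this] AE_space show ?thesis
      by eventually_elim (auto simp: B_def)
  qed
  then have "AE \<omega> in Q. \<forall>n. \<not> (\<forall>k\<ge>n. - 1 / 2 \<le> Y k \<omega>)"
    by (simp add: AE_all_countable)
  then show ?thesis
    by eventually_elim (auto simp: INFM_nat_le not_le)
qed

section \<open>Variance growth and sparse points on a coordinate axis\<close>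

text \<open>Doubling the argument eventually multiplies \<open>f\<close> by at most \<open>2 powr q\<close>, because the limiting factor is
  \<open>2 powr \<beta>\<close>; iterating this over dyadic scales gives the power bound, and monotonicity covers the
  bounded range below the first scale.\<close>

lemma regularly_varying_at_infinity_powr_bound:
  assumes rv: "regularly_varying_at_infinity f \<beta>" and mono: "mono_on {0..} f"
    and nonneg: "\<And>t. t \<ge> 0 \<Longrightarrow> 0 \<le> f t" and q: "\<beta> < q" "0 \<le> q"
  shows "\<exists>C\<ge>0. \<forall>t\<ge>1. f t \<le> C * t powr q"
proof -
  have "((\<lambda>t. f (2 * t) / f t) \<longlongrightarrow> 2 powr \<beta>) at_top"
    using rv by (simp add: regularly_varying_at_infinity_def)
  then have "eventually (\<lambda>t. f (2 * t) / f t < 2 powr q) at_top"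
    using q by (intro order_tendstoD(2)) auto
  moreover have "eventually (\<lambda>t. 0 < f t) at_top"
    using rv by (simp add: regularly_varying_at_infinity_def)
  ultimately have "eventually (\<lambda>t. f (2 * t) \<le> 2 powr q * f t) at_top"
    by eventually_elim (simp add: field_simps)
  then obtain T' where T': "\<And>t. t \<ge> T' \<Longrightarrow> f (2 * t) \<le> 2 powr q * f t"
    by (auto simp: eventually_at_top_linorder)
  define T where "T = max 1 T'"
  define M where "M = f (2 * T)"
  have T: "T \<ge> 1" and dbl: "\<And>t. t \<ge> T \<Longrightarrow> f (2 * t) \<le> 2 powr q * f t"
    using T' by (auto simp: T_def)
  have M: "M \<ge> 0" using T nonneg by (simp add: M_def)
  have small: "f t \<le> M * t powr q" if "1 \<le> t" "t \<le> 2 * T" for t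
  proof -
    have "f t \<le> M" unfolding M_def using mono by (rule mono_onD) (use that in auto)
    also have "\<dots> \<le> M * t powr q"
      using that q M by (simp add: mult_le_cancel_left1 ge_one_powr_ge_zero)
    finally show ?thesis .
  qed
  have dyadic: "f t \<le> M * t powr q" if "1 \<le> t" "t \<le> 2 ^ n * T" for n t
    using that
  proof (induction n arbitrary: t)
    case 0
    then show ?case using small T by simp
  next
    case (Suc n)
    show ?case
    proof (cases "t \<le> 2 * T")
      case True
      then show ?thesis using small Suc.prems by simp
    next
      case False
      then have "f t \<le> 2 powr q * f (t / 2)" using dbl[of "t / 2"] by simp
      also have "\<dots> \<le> 2 powr q * (M * (t / 2) powr q)"
        using False Suc T by (intro mult_left_mono Suc.IH) auto
      also have "\<dots> = M * t powr q"
        using Suc.prems by (simp add: powr_divide)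
      finally show ?thesis .
    qed
  qed
  have "f t \<le> M * t powr q" if "t \<ge> 1" for t
  proof -
    obtain n where "t / T < 2 ^ n" using real_arch_pow[of 2 "t / T"] by auto
    then have "t \<le> 2 ^ n * T" using T by (simp add: field_simps)
    then show ?thesis using dyadic that by blast
  qed
  with M show ?thesis by blast
qed

text \<open>By the mean value theorem the increment is \<open>s * deriv f u\<close> with \<open>t - s < u < t\<close>, and
  \<open>deriv f u \<le> c * f u / u\<close>.\<close>

lemma increment_le_of_log_derivative_bound:
  fixes f :: "real \<Rightarrow> real"
  assumes diff: "f differentiable_on {0<..}" and mono: "mono_on {0..} f"
    and nonneg: "\<And>t. t \<ge> 0 \<Longrightarrow> 0 \<le> f t"
    and c: "0 \<le> c" "\<And>t. t > 0 \<Longrightarrow> t * \<bar>deriv f t\<bar> \<le> c * f t" and st: "0 < s" "s < t"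
  shows "f t - f (t - s) \<le> s * c * f t / (t - s)"
proof -
  have "DERIV f u :> deriv f u" if "u > 0" for u
    using diff that
    by (metis DERIV_deriv_iff_real_differentiable differentiable_on_def greaterThan_iff open_greaterThan
        at_within_open)
  then obtain u where u: "t - s < u" "u < t" and eq: "f t - f (t - s) = (t - (t - s)) * deriv f u"
    using MVT2[of "t - s" t f "deriv f"] st by auto
  have "deriv f u \<le> c * f u / u"
    using c(2)[of u] u st by (simp add: field_simps) (smt (verit) mult_left_mono)
  also have "\<dots> \<le> c * f t / (t - s)"
    using u st c(1) nonneg[of t] mono_onD[OF mono, of u t] by (intro frac_le mult_left_mono) auto
  finally have "s * deriv f u \<le> s * (c * f t / (t - s))"
    using st by (intro mult_left_mono) auto
  then show ?thesis using eq by simp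
qed

text \<open>The quotient is the correlation of the increments of a field over \<open>[0, s]\<close> and \<open>[0, t]\<close>.  With \<open>s\<close> in a
  fixed compact interval, \<open>(f s)\<^sup>2\<close> contributes at most \<open>f s / (2 * f t)\<close>, which vanishes since \<open>f\<close> is
  unbounded; factoring the difference of squares bounds the rest by \<open>(f t - f (t - s)) / f s\<close>, which is of
  the order of \<open>f t / t\<close>.\<close>

lemma increment_correlation_tends_to_0:
  fixes f :: "real \<Rightarrow> real"
  assumes mono: "mono_on {0..} f" and nonneg: "\<And>t. t \<ge> 0 \<Longrightarrow> 0 \<le> f t"
    and lim: "filterlim f at_top at_top" and sublin: "((\<lambda>t. f t / t) \<longlongrightarrow> 0) at_top"
    and incr: "\<And>s t. 0 < s \<Longrightarrow> s < t \<Longrightarrow> f t - f (t - s) \<le> s * c * f t / (t - s)"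
    and c: "0 \<le> c"
    and T0: "0 < T0" "0 < f T0" and e: "0 < e"
  shows "eventually (\<lambda>t. \<forall>s\<in>{T0..T}. ((f s)\<^sup>2 + (f t)\<^sup>2 - (f (t - s))\<^sup>2) / (2 * f s * f t) \<le> e) at_top"
proof -
  have "((\<lambda>t. f T * inverse (f t) / 2 + T * c / f T0 * (f t / t * (t / (t - T)))) \<longlongrightarrow>
      f T * 0 / 2 + T * c / f T0 * (0 * 1)) at_top"
  proof (intro tendsto_intros sublin)
    show "((\<lambda>t. inverse (f t)) \<longlongrightarrow> 0) at_top"
      using lim by (rule tendsto_inverse_0_at_top)
    show "((\<lambda>t. t / (t - T)) \<longlongrightarrow> 1) at_top" by real_asymp
  qed auto
  then have "eventually (\<lambda>t. f T * inverse (f t) / 2 + T * c / f T0 * (f t / t * (t / (t - T))) < e) at_top"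
    using e by (intro order_tendstoD(2)) auto
  moreover have "eventually (\<lambda>t. f t > 0) at_top"
    using lim by (auto simp: filterlim_at_top_dense)
  ultimately show ?thesis
    using eventually_gt_at_top[of "max T 0"]
  proof eventually_elim
    case (elim t)
    show ?case
    proof
      fix s assume s: "s \<in> {T0..T}"
      have fs: "f T0 \<le> f s" "f s \<le> f T"
        using s T0 by (auto intro!: mono_onD[OF mono])
      have fts: "f (t - s) \<le> f t" "0 \<le> f (t - s)"
        using s T0 elim by (auto intro!: mono_onD[OF mono] nonneg)
      have "((f s)\<^sup>2 + (f t)\<^sup>2 - (f (t - s))\<^sup>2) / (2 * f s * f t) =
          f s / (2 * f t) + (f t - f (t - s)) * (f t + f (t - s)) / (2 * f s * f t)"
        using fs T0 elim by (simp add: field_simps power2_eq_square)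
      also have "\<dots> \<le> f T / (2 * f t) + (f t - f (t - s)) * (f t + f t) / (2 * f s * f t)"
        using fs fts T0 elim by (intro add_mono divide_right_mono mult_left_mono) auto
      also have "(f t - f (t - s)) * (f t + f t) / (2 * f s * f t) = (f t - f (t - s)) / f s"
        using fs T0 elim by (simp add: field_simps)
      also have "\<dots> \<le> (s * c * f t / (t - s)) / f T0"
        using s T0 elim fs fts incr[of s t] by (intro frac_le) auto
      also have "\<dots> \<le> (T * c * f t / (t - T)) / f T0"
        using s T0 elim c by (intro divide_right_mono frac_le mult_right_mono mult_nonneg_nonneg) auto
      also have "f T / (2 * f t) + \<dots> =
          f T * inverse (f t) / 2 + T * c / f T0 * (f t / t * (t / (t - T)))"
        using elim T0 by (simp add: field_simps)
      also have "\<dots> < e" using elim by simp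
      finally show "((f s)\<^sup>2 + (f t)\<^sup>2 - (f (t - s))\<^sup>2) / (2 * f s * f t) \<le> e" by simp
    qed
  qed
qed

lemma block_norm_le_norm: "block_norm blk i x \<le> norm x"
  unfolding block_norm_def norm_vec_def
  by (simp add: L2_set_def) (intro sum_mono2; simp)

lemma block_norm_nonneg: "0 \<le> block_norm blk i x"
  by (simp add: block_norm_def)

lemma block_norm_axis:
  "block_norm blk i (t *\<^sub>R axis j 1) = (if blk j = i then \<bar>t\<bar> else 0)"
proof -
  have "(\<Sum>k | blk k = i. ((t *\<^sub>R axis j 1 :: real ^ 'a) $ k)\<^sup>2) = (\<Sum>k | blk k = i. if k = j then t\<^sup>2 else 0)"
    by (intro sum.cong) (auto simp: axis_def)
  then show ?thesis
    by (simp add: block_norm_def L2_set_def sum.delta)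
qed

lemma gaussian_environmentE:
  assumes "gaussian_environment Q W \<gamma>"
  obtains l dims blk \<sigma> c where "block_decomposition l dims blk"
    and "\<forall>i\<in>{1..l}. (\<forall>t\<ge>0. 0 \<le> \<sigma> i t) \<and> mono_on {0..} (\<sigma> i)"
    and "\<forall>x. (\<gamma> x)\<^sup>2 = (\<Sum>i=1..l. (\<sigma> i (block_norm blk i x))\<^sup>2)"
    and "\<forall>i\<in>{1..l}. \<sigma> i differentiable_on {0<..} \<and> continuous_on {0<..} (deriv (\<sigma> i)) \<and>
      (\<exists>\<alpha>\<in>{0<..<1}. regularly_varying_at_zero (\<sigma> i) \<alpha>) \<and>
      (\<exists>\<beta>\<in>{0<..<1}. regularly_varying_at_infinity (\<sigma> i) \<beta>)"
    and "0 < c" and "\<forall>i\<in>{1..l}. \<forall>t>0. t * \<bar>deriv (\<sigma> i) t\<bar> \<le> c * \<sigma> i t"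
  using assms unfolding gaussian_environment_def
  by (elim conjE exE) (rule that; assumption)

text \<open>The exponent \<open>q\<close> has to serve all blocks at once; it is taken close to one, beyond all the
  indices at infinity.\<close>

lemma gaussian_environment_variance_growth:
  fixes \<gamma> :: "real ^ 'n \<Rightarrow> real"
  assumes "gaussian_environment Q W \<gamma>"
  obtains C q where "0 \<le> C" "0 < q" "q < 1"
    and "\<And>x r. 1 \<le> r \<Longrightarrow> norm x \<le> r \<Longrightarrow> \<gamma> x \<le> C * r powr q"
proof -
  from assms obtain l dims blk \<sigma> c where
    mono_nonneg: "\<forall>i\<in>{1..l}. (\<forall>t\<ge>0. 0 \<le> \<sigma> i t) \<and> mono_on {0..} (\<sigma> i)"
    and split': "\<forall>x. (\<gamma> x)\<^sup>2 = (\<Sum>i=1..l. (\<sigma> i (block_norm blk i x))\<^sup>2)"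
    and reg: "\<forall>i\<in>{1..l}. \<sigma> i differentiable_on {0<..} \<and> continuous_on {0<..} (deriv (\<sigma> i)) \<and>
      (\<exists>\<alpha>\<in>{0<..<1}. regularly_varying_at_zero (\<sigma> i) \<alpha>) \<and>
      (\<exists>\<beta>\<in>{0<..<1}. regularly_varying_at_infinity (\<sigma> i) \<beta>)"
    by (rule gaussian_environmentE)
  have nonneg: "0 \<le> \<sigma> i t" if "i \<in> {1..l}" "t \<ge> 0" for i t
    using mono_nonneg that by blast
  have mono: "mono_on {0..} (\<sigma> i)" if "i \<in> {1..l}" for i
    using mono_nonneg that by blast
  have split: "(\<gamma> x)\<^sup>2 = (\<Sum>i=1..l. (\<sigma> i (block_norm blk i x))\<^sup>2)" for x
    using split' by (rule spec)
  have rv: "\<forall>i\<in>{1..l}. \<exists>\<beta>\<in>{0<..<1}. regularly_varying_at_infinity (\<sigma> i) \<beta>"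
    using reg by blast
  have "\<forall>i\<in>{1..l}. eventually (\<lambda>q. \<exists>C\<ge>0. \<forall>t\<ge>1. \<sigma> i t \<le> C * t powr q) (at_left (1::real))"
  proof
    fix i assume i: "i \<in> {1..l}"
    with rv obtain \<beta> where \<beta>: "\<beta> \<in> {0<..<1}" "regularly_varying_at_infinity (\<sigma> i) \<beta>" by blast
    have "eventually (\<lambda>q. q \<in> {\<beta><..<1}) (at_left (1::real))"
      using \<beta>(1) by (intro eventually_at_leftI) auto
    then show "eventually (\<lambda>q. \<exists>C\<ge>0. \<forall>t\<ge>1. \<sigma> i t \<le> C * t powr q) (at_left (1::real))"
    proof eventually_elim
      case (elim q)
      then show ?case
        using \<beta> i mono nonneg by (intro regularly_varying_at_infinity_powr_bound[of _ \<beta>]) auto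
    qed
  qed
  then have "eventually (\<lambda>q. \<forall>i\<in>{1..l}. \<exists>C\<ge>0. \<forall>t\<ge>1. \<sigma> i t \<le> C * t powr q) (at_left (1::real))"
    by (intro eventually_ball_finite) auto
  moreover have "eventually (\<lambda>q. q \<in> {0<..<1}) (at_left (1::real))"
    by (intro eventually_at_leftI[of 0]) auto
  ultimately have "eventually (\<lambda>q. q \<in> {0<..<1} \<and>
      (\<forall>i\<in>{1..l}. \<exists>C\<ge>0. \<forall>t\<ge>1. \<sigma> i t \<le> C * t powr q)) (at_left (1::real))"
    by eventually_elim auto
  then obtain q where q: "q \<in> {0<..<1}" and ex: "\<forall>i\<in>{1..l}. \<exists>C\<ge>0. \<forall>t\<ge>1. \<sigma> i t \<le> C * t powr q"
    using eventually_happens' trivial_limit_at_left_real by blast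
  then obtain C where C: "\<And>i. i \<in> {1..l} \<Longrightarrow> C i \<ge> 0"
      "\<And>i t. i \<in> {1..l} \<Longrightarrow> t \<ge> 1 \<Longrightarrow> \<sigma> i t \<le> C i * t powr q"
    by metis
  define S where "S = sqrt (\<Sum>i=1..l. (C i)\<^sup>2)"
  show thesis
  proof
    show "0 \<le> S" by (simp add: S_def sum_nonneg)
    show "0 < q" "q < 1" using q by auto
    fix x :: "real ^ 'n" and r :: real assume r: "1 \<le> r" "norm x \<le> r"
    have "(\<gamma> x)\<^sup>2 \<le> (\<Sum>i=1..l. (C i * r powr q)\<^sup>2)"
      unfolding split
    proof (intro sum_mono power_mono)
      fix i assume i: "i \<in> {1..l}"
      have le: "block_norm blk i x \<le> r" using block_norm_le_norm[of blk i x] r by simp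
      have "\<sigma> i (block_norm blk i x) \<le> \<sigma> i r"
        using r le by (intro mono_onD[OF mono[OF i]]) (auto simp: block_norm_nonneg)
      also have "\<dots> \<le> C i * r powr q" using C i r by auto
      finally show "\<sigma> i (block_norm blk i x) \<le> C i * r powr q" .
      show "0 \<le> \<sigma> i (block_norm blk i x)" using nonneg i by (simp add: block_norm_nonneg)
    qed
    also have "\<dots> = (S * r powr q)\<^sup>2"
      by (simp add: S_def power_mult_distrib sum_nonneg sum_distrib_right)
    finally show "\<gamma> x \<le> S * r powr q"
      by (rule power2_le_imp_le) (simp add: S_def sum_nonneg)
  qed
qed

text \<open>The points lie on a coordinate axis, where only one block norm is nonzero.  That \<open>\<gamma> 0 = 0\<close> makes every
  \<open>\<sigma> i 0\<close> vanish, so that \<open>\<gamma>\<close> restricted to the axis is a single \<open>\<sigma> i\<close>.  Each point is chosen far enough beyond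
  its predecessor; the correlation bound is uniform over the compact segment containing all earlier points, so
  the choice depends on the predecessor alone.\<close>

lemma gaussian_environment_sparse_points:
  fixes \<gamma> :: "real ^ 'n \<Rightarrow> real" and g :: "nat \<Rightarrow> real"
  assumes env: "gaussian_environment Q W \<gamma>"
  obtains x :: "nat \<Rightarrow> real ^ 'n" where "\<And>k. 0 < \<gamma> (x k)" "\<And>k. g k \<le> \<gamma> (x k)"
    and "\<And>j k. j < k \<Longrightarrow>
      ((\<gamma> (x j))\<^sup>2 + (\<gamma> (x k))\<^sup>2 - (\<gamma> (x k - x j))\<^sup>2) / (2 * \<gamma> (x j) * \<gamma> (x k)) \<le> (1 / 4) ^ k"
proof -
  from env obtain l dims blk \<sigma> c where
    blk: "block_decomposition l dims (blk :: 'n \<Rightarrow> nat)"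
    and mono_nonneg: "\<forall>i\<in>{1..l}. (\<forall>t\<ge>0. 0 \<le> \<sigma> i t) \<and> mono_on {0..} (\<sigma> i)"
    and split': "\<forall>x. (\<gamma> x)\<^sup>2 = (\<Sum>i=1..l. (\<sigma> i (block_norm blk i x))\<^sup>2)"
    and reg: "\<forall>i\<in>{1..l}. \<sigma> i differentiable_on {0<..} \<and> continuous_on {0<..} (deriv (\<sigma> i)) \<and>
      (\<exists>\<alpha>\<in>{0<..<1}. regularly_varying_at_zero (\<sigma> i) \<alpha>) \<and>
      (\<exists>\<beta>\<in>{0<..<1}. regularly_varying_at_infinity (\<sigma> i) \<beta>)"
    and c: "0 < c" and log_deriv: "\<forall>i\<in>{1..l}. \<forall>t>0. t * \<bar>deriv (\<sigma> i) t\<bar> \<le> c * \<sigma> i t"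
    by (rule gaussian_environmentE)
  have nonneg: "0 \<le> \<sigma> i t" if "i \<in> {1..l}" "t \<ge> 0" for i t
    using mono_nonneg that by blast
  have mono: "mono_on {0..} (\<sigma> i)" if "i \<in> {1..l}" for i
    using mono_nonneg that by blast
  have split: "(\<gamma> x)\<^sup>2 = (\<Sum>i=1..l. (\<sigma> i (block_norm blk i x))\<^sup>2)" for x
    using split' by (rule spec)
  have diff: "\<sigma> i differentiable_on {0<..}" if "i \<in> {1..l}" for i
    using reg that by blast
  have \<gamma>0: "\<gamma> 0 = 0" and pos: "\<And>x. x \<noteq> 0 \<Longrightarrow> 0 < \<gamma> x"
    and div: "LIM x at_infinity. \<gamma> x * sqrt (ln (ln (norm x))) / ln (norm x) :> at_top"
    using env unfolding gaussian_environment_def by (elim conjE; blast)+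
  define j :: 'n where "j = undefined"
  define e :: "real ^ 'n" where "e = axis j 1"
  define f where "f = \<sigma> (blk j)"
  have bj: "blk j \<in> {1..l}" using blk by (auto simp: block_decomposition_def)
  have \<sigma>0: "\<sigma> i 0 = 0" if "i \<in> {1..l}" for i
  proof -
    have "(\<Sum>i=1..l. (\<sigma> i 0)\<^sup>2) = 0"
      using split[of 0] \<gamma>0 by (simp add: block_norm_def L2_set_def)
    then show ?thesis using that by (subst (asm) sum_nonneg_eq_0_iff) auto
  qed
  have \<gamma>f: "\<gamma> (t *\<^sub>R e) = f t" if "t \<ge> 0" for t
  proof -
    have "(\<gamma> (t *\<^sub>R e))\<^sup>2 = (\<Sum>i=1..l. if i = blk j then (f t)\<^sup>2 else 0)"
      unfolding split e_def block_norm_axis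
      using that \<sigma>0 by (intro sum.cong) (auto simp: f_def)
    then have "(\<gamma> (t *\<^sub>R e))\<^sup>2 = (f t)\<^sup>2" using bj by simp
    moreover have "0 \<le> \<gamma> (t *\<^sub>R e)"
      using \<gamma>0 pos[of "t *\<^sub>R e"] by (cases "t *\<^sub>R e = 0") auto
    moreover have "0 \<le> f t" using nonneg[OF bj that] by (simp add: f_def)
    ultimately show ?thesis by (simp add: power2_eq_iff_nonneg)
  qed
  have ne: "norm e = 1" "e \<noteq> 0" by (auto simp: e_def axis_eq_0_iff)
  have lim: "filterlim f at_top at_top"
  proof -
    have "filterlim (\<lambda>t. t *\<^sub>R e) at_infinity at_top"
    proof (rule filterlim_norm_at_top_imp_at_infinity)
      show "filterlim (\<lambda>t. norm (t *\<^sub>R e)) at_top at_top"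
        using filterlim_abs_real by (simp add: ne)
    qed
    from filterlim_compose[OF div this]
    have "LIM t at_top. \<gamma> (t *\<^sub>R e) * sqrt (ln (ln \<bar>t\<bar>)) / ln \<bar>t\<bar> :> at_top"
      by (simp add: ne)
    \<comment> \<open>The assumed divergence has the factor \<open>sqrt (ln (ln t)) / ln t\<close>, which tends to zero; its inverse is put back.\<close>
    moreover have "LIM t at_top. ln t / sqrt (ln (ln t)) :> (at_top :: real filter)"
      by real_asymp
    ultimately have "LIM t at_top. (\<gamma> (t *\<^sub>R e) * sqrt (ln (ln \<bar>t\<bar>)) / ln \<bar>t\<bar>) *
        (ln t / sqrt (ln (ln t))) :> at_top"
      by (rule filterlim_at_top_mult_at_top)
    moreover have "eventually (\<lambda>t::real. ln t > 1) at_top" by real_asymp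
    then have "eventually (\<lambda>t. (\<gamma> (t *\<^sub>R e) * sqrt (ln (ln \<bar>t\<bar>)) / ln \<bar>t\<bar>) *
        (ln t / sqrt (ln (ln t))) = f t) at_top"
      using eventually_gt_at_top[of 0]
    proof eventually_elim
      case (elim t)
      then have "ln (ln t) > 0" "ln t \<noteq> 0" by (auto intro!: ln_gt_zero)
      with elim(2) show ?case using \<gamma>f[of t] by simp
    qed
    ultimately show ?thesis
      by - (rule filterlim_cong[THEN iffD1, OF refl refl])
  qed
  obtain C q where Cq: "0 \<le> C" "0 < q" "q < 1"
    and growth: "\<And>x r. 1 \<le> r \<Longrightarrow> norm x \<le> r \<Longrightarrow> \<gamma> x \<le> C * r powr q"
    using gaussian_environment_variance_growth[OF env] by metis
  have sublin: "((\<lambda>t. f t / t) \<longlongrightarrow> 0) at_top"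
  proof (rule tendsto_sandwich)
    show "((\<lambda>t. 0::real) \<longlongrightarrow> 0) at_top" by simp
    show "((\<lambda>t::real. C * t powr q / t) \<longlongrightarrow> 0) at_top"
      using Cq by real_asymp
    show "eventually (\<lambda>t. 0 \<le> f t / t) at_top"
      using eventually_gt_at_top[of 0] by eventually_elim (use nonneg[OF bj] in \<open>auto simp: f_def\<close>)
    show "eventually (\<lambda>t. f t / t \<le> C * t powr q / t) at_top"
      using eventually_ge_at_top[of 1]
    proof eventually_elim
      case (elim t)
      then show ?case
        using growth[of t "t *\<^sub>R e"] \<gamma>f[of t] ne by (intro divide_right_mono) auto
    qed
  qed
  have incr: "f t - f (t - s) \<le> s * c * f t / (t - s)" if "0 < s" "s < t" for s t
    unfolding f_def using c log_deriv bj nonneg that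
    by (intro increment_le_of_log_derivative_bound diff mono) auto
  let ?r = "\<lambda>s t. ((f s)\<^sup>2 + (f t)\<^sup>2 - (f (t - s))\<^sup>2) / (2 * f s * f t)"
  have f_pos: "f t > 0" if "t > 0" for t
    using \<gamma>f[of t] pos[of "t *\<^sub>R e"] that ne by simp
  have "\<exists>t. \<forall>k. (1 \<le> t k \<and> g k \<le> f (t k)) \<and>
      (t k < t (Suc k) \<and> (\<forall>s\<in>{1..t k}. ?r s (t (Suc k)) \<le> (1 / 4) ^ Suc k))"
  proof (rule dependent_nat_choice)
    have "eventually (\<lambda>t. 1 \<le> t \<and> g 0 \<le> f t) at_top"
      using eventually_ge_at_top[of 1] lim[unfolded filterlim_at_top, rule_format, of "g 0"]
      by eventually_elim auto
    then show "\<exists>t. 1 \<le> t \<and> g 0 \<le> f t"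
      using eventually_happens' trivial_limit_at_top_linorder by blast
  next
    fix T :: real and k assume "1 \<le> T \<and> g k \<le> f T"
    have "eventually (\<lambda>t. \<forall>s\<in>{1..T}. ?r s t \<le> (1 / 4) ^ Suc k) at_top"
      using mono[OF bj] nonneg[OF bj] lim sublin incr c f_pos
      by (intro increment_correlation_tends_to_0[where c = c]) (auto simp: f_def)
    then have "eventually (\<lambda>t. (1 \<le> t \<and> g (Suc k) \<le> f t) \<and>
        (T < t \<and> (\<forall>s\<in>{1..T}. ?r s t \<le> (1 / 4) ^ Suc k))) at_top"
      using eventually_ge_at_top[of 1] eventually_gt_at_top[of T]
        lim[unfolded filterlim_at_top, rule_format, of "g (Suc k)"]
      by eventually_elim auto
    then show "\<exists>t. (1 \<le> t \<and> g (Suc k) \<le> f t) \<and>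
        (T < t \<and> (\<forall>s\<in>{1..T}. ?r s t \<le> (1 / 4) ^ Suc k))"
      using eventually_happens' trivial_limit_at_top_linorder by blast
  qed
  then obtain t where t1: "\<And>k. 1 \<le> t k" and tg: "\<And>k. g k \<le> f (t k)"
    and tS: "\<And>k. t k < t (Suc k)" and r: "\<And>k s. 1 \<le> s \<Longrightarrow> s \<le> t k \<Longrightarrow> ?r s (t (Suc k)) \<le> (1 / 4) ^ Suc k"
    by (metis atLeastAtMost_iff)
  have t_less: "t j < t k" if "j < k" for j k
    using tS that by (rule lift_Suc_mono_less)
  have \<gamma>t: "\<gamma> (t k *\<^sub>R e) = f (t k)" for k using \<gamma>f t1[of k] by simp
  show thesis
  proof
    fix k
    show "0 < \<gamma> (t k *\<^sub>R e)" using f_pos[of "t k"] t1[of k] by (simp add: \<gamma>t)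
    show "g k \<le> \<gamma> (t k *\<^sub>R e)" using tg by (simp add: \<gamma>t)
  next
    fix j k :: nat assume jk: "j < k"
    then obtain m where m: "k = Suc m" by (cases k) auto
    have le: "t j \<le> t m" using t_less[of j m] jk m by (cases "j = m") auto
    have "\<gamma> (t k *\<^sub>R e - t j *\<^sub>R e) = f (t k - t j)"
      using \<gamma>f[of "t k - t j"] t_less[OF jk] by (simp add: scaleR_diff_left)
    then show "((\<gamma> (t j *\<^sub>R e))\<^sup>2 + (\<gamma> (t k *\<^sub>R e))\<^sup>2 - (\<gamma> (t k *\<^sub>R e - t j *\<^sub>R e))\<^sup>2)
        / (2 * \<gamma> (t j *\<^sub>R e) * \<gamma> (t k *\<^sub>R e)) \<le> (1 / 4) ^ k"
      using r[OF t1 le] by (simp add: \<gamma>t m)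
  qed
qed

section \<open>Joint measurability of continuous fields\<close>

text \<open>By continuity the field is the limit of its values at the grid points of mesh \<open>1 / (n + 1)\<close>, and for
  each \<open>n\<close> the rounded field is jointly measurable since it takes only countably many spatial arguments.\<close>

lemma borel_measurable_pair_continuous_field:
  fixes V :: "real ^ 'n \<Rightarrow> 'w \<Rightarrow> real"
  assumes meas [measurable]: "\<And>x. V x \<in> borel_measurable M"
    and cont: "\<And>\<omega>. continuous_on UNIV (\<lambda>x. V x \<omega>)"
  shows "(\<lambda>(x, \<omega>). V x \<omega>) \<in> borel_measurable (borel \<Otimes>\<^sub>M M)"
proof -
  define r :: "nat \<Rightarrow> int ^ 'n \<Rightarrow> real ^ 'n"
    where "r n a = (\<chi> i. of_int (a $ i) / real (Suc n))" for n a
  define g :: "nat \<Rightarrow> real ^ 'n \<Rightarrow> int ^ 'n"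
    where "g n x = (\<chi> i. \<lfloor>real (Suc n) * x $ i\<rfloor>)" for n x
  have meas_g: "(\<lambda>p. g n (fst p)) \<in> measurable (borel \<Otimes>\<^sub>M M) (count_space UNIV)" for n
  proof -
    have "g n -` {a} \<in> sets borel" for a
    proof -
      have "g n -` {a} = {x \<in> space borel. \<forall>i. \<lfloor>real (Suc n) * x $ i\<rfloor> = a $ i}"
        by (auto simp: g_def vec_eq_iff)
      also have "\<dots> \<in> sets borel" by measurable
      finally show ?thesis .
    qed
    then have "g n \<in> measurable borel (count_space UNIV)"
      by (subst measurable_count_space_eq_countable) auto
    then show ?thesis by (rule measurable_compose[OF measurable_fst])
  qed
  have lim: "(\<lambda>n. r n (g n x)) \<longlonglongrightarrow> x" for x
  proof (rule vec_tendstoI)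
    fix i
    have "\<bar>of_int \<lfloor>real (Suc n) * x $ i\<rfloor> / real (Suc n) - x $ i\<bar> \<le> 1 / real (Suc n)" for n
    proof -
      have "of_int \<lfloor>real (Suc n) * x $ i\<rfloor> / real (Suc n) - x $ i =
          (of_int \<lfloor>real (Suc n) * x $ i\<rfloor> - real (Suc n) * x $ i) / real (Suc n)"
        by (simp add: field_simps)
      also have "\<bar>\<dots>\<bar> \<le> 1 / real (Suc n)"
        unfolding abs_divide by (intro frac_le) linarith+
      finally show ?thesis .
    qed
    then have "(\<lambda>n. of_int \<lfloor>real (Suc n) * x $ i\<rfloor> / real (Suc n) - x $ i) \<longlonglongrightarrow> 0"
      by (intro Lim_null_comparison[OF _ LIMSEQ_Suc[OF lim_1_over_n]]) auto
    then show "(\<lambda>n. r n (g n x) $ i) \<longlonglongrightarrow> x $ i"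
      by (simp add: r_def g_def LIM_zero_iff)
  qed
  show ?thesis
  proof (rule borel_measurable_LIMSEQ_real[where u = "\<lambda>n p. V (r n (g n (fst p))) (snd p)"])
    fix p :: "(real ^ 'n) \<times> 'w" assume "p \<in> space (borel \<Otimes>\<^sub>M M)"
    have "isCont (\<lambda>x. V x (snd p)) (fst p)"
      using cont[of "snd p"] by (simp add: continuous_on_eq_continuous_at)
    then show "(\<lambda>n. V (r n (g n (fst p))) (snd p)) \<longlonglongrightarrow> (case p of (x, \<omega>) \<Rightarrow> V x \<omega>)"
      using isCont_tendsto_compose[OF _ lim] by (simp add: case_prod_beta)
  next
    fix n
    show "(\<lambda>p. V (r n (g n (fst p))) (snd p)) \<in> borel_measurable (borel \<Otimes>\<^sub>M M)"
      by (rule measurable_compose_countable[OF _ meas_g]) measurable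
  qed
qed

section \<open>Unit cells and lattice cubes\<close>

abbreviation unit_cell :: "real ^ 'n \<Rightarrow> (real ^ 'n) set" where
  "unit_cell z \<equiv> cbox z (z + 1)"

lemma emeasure_unit_cell: "emeasure lborel (unit_cell (z :: real ^ 'n)) = 1"
proof -
  have "(1 :: real ^ 'n) \<bullet> b = 1" if "b \<in> Basis" for b
    using that by (auto simp: Basis_vec_def inner_axis)
  then show ?thesis by (subst emeasure_lborel_cbox) (auto simp: inner_add_left)
qed

lemma norm_diff_le_of_unit_cell:
  fixes y z :: "real ^ 'n"
  assumes "y \<in> unit_cell z"
  shows "norm (y - z) \<le> CARD('n)"
proof -
  have "norm (y - z) \<le> (\<Sum>i\<in>UNIV. \<bar>(y - z) $ i\<bar>)" by (rule norm_le_l1_cart)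
  also have "\<dots> \<le> (\<Sum>i\<in>(UNIV :: 'n set). 1)"
  proof (rule sum_mono)
    fix i
    have "z $ i \<le> y $ i \<and> y $ i \<le> z $ i + 1"
      using assms by (auto simp: mem_box_cart)
    then show "\<bar>(y - z) $ i\<bar> \<le> 1" by auto
  qed
  finally show ?thesis by simp
qed

definition lattice_cube :: "nat \<Rightarrow> (real ^ 'n) set" where
  "lattice_cube n = {z. \<forall>i. z $ i \<in> real_of_int ` {- int n..int n}}"

lemma lattice_cube_eq_image:
  "lattice_cube n = (\<lambda>f. \<chi> i. real_of_int (f i)) ` (UNIV \<rightarrow>\<^sub>E {- int n..int n})"
proof (intro equalityI subsetI)
  fix z :: "real ^ 'a" assume "z \<in> lattice_cube n"
  then have "\<forall>i. \<exists>a. a \<in> {- int n..int n} \<and> z $ i = of_int a"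
    unfolding lattice_cube_def by blast
  then obtain f where "\<forall>i. f i \<in> {- int n..int n} \<and> z $ i = of_int (f i)" by metis
  then show "z \<in> (\<lambda>f. \<chi> i. real_of_int (f i)) ` (UNIV \<rightarrow>\<^sub>E {- int n..int n})"
    by (intro image_eqI[of _ _ f]) (auto simp: vec_eq_iff)
next
  fix z :: "real ^ 'a" assume "z \<in> (\<lambda>f. \<chi> i. real_of_int (f i)) ` (UNIV \<rightarrow>\<^sub>E {- int n..int n})"
  then obtain f where z: "z = (\<chi> i. real_of_int (f i))" and f: "f \<in> UNIV \<rightarrow>\<^sub>E {- int n..int n}"
    by (rule imageE)
  have "z $ i \<in> real_of_int ` {- int n..int n}" for i
    unfolding z vec_lambda_beta by (intro imageI PiE_mem[OF f]) simp
  then show "z \<in> lattice_cube n"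
    unfolding lattice_cube_def by (intro CollectI allI)
qed

lemma finite_lattice_cube: "finite (lattice_cube n :: (real ^ 'n) set)"
  and card_lattice_cube: "card (lattice_cube n :: (real ^ 'n) set) \<le> (2 * n + 1) ^ CARD('n)"
proof -
  let ?F = "(UNIV :: 'n set) \<rightarrow>\<^sub>E {- int n..int n}"
  have fin: "finite ?F" by (intro finite_PiE) auto
  then show "finite (lattice_cube n :: (real ^ 'n) set)"
    by (simp add: lattice_cube_eq_image)
  have "card (lattice_cube n :: (real ^ 'n) set) \<le> card ?F"
    unfolding lattice_cube_eq_image by (rule card_image_le[OF fin])
  also have "\<dots> = (2 * n + 1) ^ CARD('n)"
    by (simp add: card_PiE nat_add_distrib nat_mult_distrib)
  finally show "card (lattice_cube n :: (real ^ 'n) set) \<le> (2 * n + 1) ^ CARD('n)" .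
qed

lemma norm_le_of_lattice_cube:
  assumes "z \<in> lattice_cube n"
  shows "norm (z :: real ^ 'n) \<le> CARD('n) * real n"
proof -
  have "norm z \<le> (\<Sum>i\<in>UNIV. \<bar>z $ i\<bar>)" by (rule norm_le_l1_cart)
  also have "\<dots> \<le> (\<Sum>i\<in>(UNIV :: 'n set). real n)"
  proof (rule sum_mono)
    fix i
    have "z $ i \<in> real_of_int ` {- int n..int n}"
      using assms unfolding lattice_cube_def mem_Collect_eq by (rule spec)
    then obtain a where "z $ i = of_int a" "a \<in> {- int n..int n}" by (rule imageE)
    then show "\<bar>z $ i\<bar> \<le> real n" by auto
  qed
  finally show ?thesis by simp
qed

lemma cball_subset_lattice_cells:
  "cball (0 :: real ^ 'n) (real n) \<subseteq> (\<Union>z\<in>lattice_cube n. unit_cell z)"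
proof
  fix x :: "real ^ 'n" assume x: "x \<in> cball 0 (real n)"
  let ?z = "(\<chi> i. of_int \<lfloor>x $ i\<rfloor>) :: real ^ 'n"
  have "\<lfloor>x $ i\<rfloor> \<in> {- int n..int n}" for i
  proof -
    have "\<bar>x $ i\<bar> \<le> real n" using component_le_norm_cart[of x i] x by simp
    then show ?thesis by (auto simp: le_floor_iff floor_le_iff)
  qed
  then have "?z \<in> lattice_cube n" by (auto simp: lattice_cube_def)
  moreover have "x \<in> unit_cell ?z"
    by (auto simp: mem_box_cart)
  ultimately show "x \<in> (\<Union>z\<in>lattice_cube n. unit_cell z)" by blast
qed

text \<open>For \<open>c = -1\<close> this is the mass of the cell divided by \<open>exp (- V z)\<close>; for \<open>c = 1\<close> it controls how far
  the field can rise above its corner value, which bounds the mass from below.\<close>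

definition cell_oscillation :: "real \<Rightarrow> (real ^ 'n \<Rightarrow> 'w \<Rightarrow> real) \<Rightarrow> real ^ 'n \<Rightarrow> 'w \<Rightarrow> ennreal" where
  "cell_oscillation c V z \<omega> =
     (\<integral>\<^sup>+ y. ennreal (exp (c * (V y \<omega> - V z \<omega>))) * indicator (unit_cell z) y \<partial>lborel)"

lemma emeasure_random_measure:
  assumes [measurable]: "(\<lambda>x. V x \<omega>) \<in> borel_measurable borel" "A \<in> sets borel"
  shows "emeasure (random_measure V \<omega>) A = (\<integral>\<^sup>+ y. ennreal (exp (- V y \<omega>)) * indicator A y \<partial>lborel)"
  unfolding random_measure_def by (subst emeasure_density) auto

lemma mass_unit_cell_eq:
  assumes [measurable]: "(\<lambda>x. V x \<omega>) \<in> borel_measurable borel"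
  shows "emeasure (random_measure V \<omega>) (unit_cell z) =
    ennreal (exp (- V z \<omega>)) * cell_oscillation (- 1) V z \<omega>"
proof -
  have split: "ennreal (exp (- V y \<omega>)) * i =
      ennreal (exp (- V z \<omega>)) * (ennreal (exp (- 1 * (V y \<omega> - V z \<omega>))) * i)" for y i
    by (simp add: ennreal_mult[symmetric] exp_add[symmetric] mult.assoc[symmetric])
  have "emeasure (random_measure V \<omega>) (unit_cell z) =
      (\<integral>\<^sup>+ y. ennreal (exp (- V y \<omega>)) * indicator (unit_cell z) y \<partial>lborel)"
    by (rule emeasure_random_measure) auto
  also have "\<dots> = (\<integral>\<^sup>+ y. ennreal (exp (- V z \<omega>)) *
      (ennreal (exp (- 1 * (V y \<omega> - V z \<omega>))) * indicator (unit_cell z) y) \<partial>lborel)"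
    by (intro nn_integral_cong split)
  also have "\<dots> = ennreal (exp (- V z \<omega>)) * cell_oscillation (- 1) V z \<omega>"
    unfolding cell_oscillation_def by (rule nn_integral_cmult) measurable
  finally show ?thesis .
qed

text \<open>Since \<open>exp u \<ge> u\<close> for all real \<open>u\<close>, adding this bound for \<open>u = - V y\<close> and \<open>u = V y - V z\<close> cancels
  \<open>V y\<close>.  The linear bound suffices as only unboundedness of the masses is at stake.\<close>

lemma le_mass_unit_cell_plus_oscillation:
  assumes [measurable]: "(\<lambda>x. V x \<omega>) \<in> borel_measurable borel"
  shows "ennreal (- V z \<omega>) \<le> emeasure (random_measure V \<omega>) (unit_cell z) + cell_oscillation 1 V z \<omega>"
proof -
  have "ennreal (- V z \<omega>) = (\<integral>\<^sup>+ y. ennreal (- V z \<omega>) * indicator (unit_cell z) y \<partial>lborel)"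
    by (simp add: nn_integral_cmult_indicator emeasure_unit_cell)
  also have "\<dots> \<le> (\<integral>\<^sup>+ y. ennreal (exp (- V y \<omega>)) * indicator (unit_cell z) y
      + ennreal (exp (1 * (V y \<omega> - V z \<omega>))) * indicator (unit_cell z) y \<partial>lborel)"
  proof (intro nn_integral_mono)
    fix y
    have "- b \<le> s + t" if "1 + - a \<le> s" "1 + 1 * (a - b) \<le> t" for a b s t :: real
      using that by simp
    from this[OF exp_ge_add_one_self exp_ge_add_one_self]
    have "- V z \<omega> \<le> exp (- V y \<omega>) + exp (1 * (V y \<omega> - V z \<omega>))" .
    then have "ennreal (- V z \<omega>) \<le> ennreal (exp (- V y \<omega>)) + ennreal (exp (1 * (V y \<omega> - V z \<omega>)))"
      by (simp add: ennreal_leI flip: ennreal_plus)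
    then show "ennreal (- V z \<omega>) * indicator (unit_cell z) y \<le>
        ennreal (exp (- V y \<omega>)) * indicator (unit_cell z) y
        + ennreal (exp (1 * (V y \<omega> - V z \<omega>))) * indicator (unit_cell z) y"
      by (auto simp: indicator_def)
  qed
  also have "\<dots> = emeasure (random_measure V \<omega>) (unit_cell z) + cell_oscillation 1 V z \<omega>"
    unfolding cell_oscillation_def
    by (subst nn_integral_add) (auto simp: emeasure_random_measure)
  finally show ?thesis .
qed

section \<open>Uniform estimates on unit cells\<close>

locale continuous_gaussian_field = prob_space Q for Q :: "'w measure" +
  fixes V :: "real ^ 'n \<Rightarrow> 'w \<Rightarrow> real" and \<gamma> :: "real ^ 'n \<Rightarrow> real"
  assumes gauss: "centered_gaussian_process Q V"
    and cont: "\<And>\<omega>. continuous_on UNIV (\<lambda>x. V x \<omega>)"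
    and increment_variance: "\<And>x y. (LINT \<omega>|Q. (V x \<omega> - V y \<omega>)\<^sup>2) = (\<gamma> (x - y))\<^sup>2"
begin

lemma field_measurable [measurable]: "V x \<in> borel_measurable Q"
  using gaussian_process_linear_combination[OF gauss, of "{x}" "\<lambda>_. 1"]
  by (simp add: centered_gaussian_def)

lemma path_measurable [measurable]: "(\<lambda>x. V x \<omega>) \<in> borel_measurable borel"
  using cont by (rule borel_measurable_continuous_onI)

lemma field_measurable_pair: "(\<lambda>(x, \<omega>). V x \<omega>) \<in> borel_measurable (borel \<Otimes>\<^sub>M Q)"
  by (intro borel_measurable_pair_continuous_field cont) measurable

lemma cell_oscillation_measurable [measurable]: "cell_oscillation c V z \<in> borel_measurable Q"
proof -
  have [measurable]: "(\<lambda>p. V (snd p) (fst p)) \<in> borel_measurable (Q \<Otimes>\<^sub>M lborel)"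
    using measurable_compose[OF _ field_measurable_pair, of "\<lambda>p. (snd p, fst p)" "Q \<Otimes>\<^sub>M lborel"]
    by simp
  show ?thesis
    unfolding cell_oscillation_def[abs_def]
    by (intro lborel.borel_measurable_nn_integral) (simp add: case_prod_beta)
qed

lemma exp_increment_moment:
  "(\<integral>\<^sup>+ \<omega>. ennreal (exp (c * (V x \<omega> - V y \<omega>))) \<partial>Q) = ennreal (exp (c\<^sup>2 * (\<gamma> (x - y))\<^sup>2 / 2))"
proof -
  have "centered_gaussian Q (\<lambda>\<omega>. V x \<omega> - V y \<omega>)"
    using gaussian_process_increment[OF gauss, of 1 x y] by simp
  from centered_gaussian_exp_moment(2,3)[OF prob_space_axioms this, of c]
  show ?thesis
    by (subst nn_integral_eq_integral) (simp_all add: increment_variance)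
qed

text \<open>By stationarity of the increments the bound does not depend on the cell.\<close>

lemma cell_oscillation_moment:
  assumes bound: "\<And>x. norm x \<le> CARD('n) \<Longrightarrow> 0 \<le> \<gamma> x \<and> \<gamma> x \<le> K"
  shows "(\<integral>\<^sup>+ \<omega>. cell_oscillation c V z \<omega> \<partial>Q) \<le> ennreal (exp (c\<^sup>2 * K\<^sup>2 / 2))"
proof -
  interpret pair_sigma_finite Q "lborel :: (real ^ 'n) measure" ..
  have [measurable]: "(\<lambda>p. V (snd p) (fst p)) \<in> borel_measurable (Q \<Otimes>\<^sub>M lborel)"
    using measurable_compose[OF _ field_measurable_pair, of "\<lambda>p. (snd p, fst p)" "Q \<Otimes>\<^sub>M lborel"]
    by simp
  have "(\<integral>\<^sup>+ \<omega>. cell_oscillation c V z \<omega> \<partial>Q) =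
      (\<integral>\<^sup>+ y. (\<integral>\<^sup>+ \<omega>. ennreal (exp (c * (V y \<omega> - V z \<omega>))) * indicator (unit_cell z) y \<partial>Q) \<partial>lborel)"
    unfolding cell_oscillation_def
    by (intro Fubini'[symmetric]) (simp add: case_prod_beta)
  also have "\<dots> = (\<integral>\<^sup>+ y. ennreal (exp (c\<^sup>2 * (\<gamma> (y - z))\<^sup>2 / 2)) * indicator (unit_cell z) y \<partial>lborel)"
    by (intro nn_integral_cong, subst nn_integral_multc) (auto simp: exp_increment_moment)
  also have "\<dots> \<le> (\<integral>\<^sup>+ y. ennreal (exp (c\<^sup>2 * K\<^sup>2 / 2)) * indicator (unit_cell z) y \<partial>lborel)"
  proof (intro nn_integral_mono)
    fix y
    show "ennreal (exp (c\<^sup>2 * (\<gamma> (y - z))\<^sup>2 / 2)) * indicator (unit_cell z) y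
        \<le> ennreal (exp (c\<^sup>2 * K\<^sup>2 / 2)) * indicator (unit_cell z) y"
    proof (cases "y \<in> unit_cell z")
      case True
      then have "(\<gamma> (y - z))\<^sup>2 \<le> K\<^sup>2"
        using bound norm_diff_le_of_unit_cell by (intro power_mono) auto
      then show ?thesis by (auto intro!: ennreal_leI mult_left_mono divide_right_mono simp: True)
    qed simp
  qed
  also have "\<dots> = ennreal (exp (c\<^sup>2 * K\<^sup>2 / 2))"
    by (simp add: nn_integral_cmult_indicator emeasure_unit_cell)
  finally show ?thesis .
qed

lemma prob_cell_oscillation_ge:
  assumes bound: "\<And>x. norm x \<le> CARD('n) \<Longrightarrow> 0 \<le> \<gamma> x \<and> \<gamma> x \<le> K" and u: "0 < u"
  shows "prob {\<omega> \<in> space Q. ennreal u \<le> cell_oscillation c V z \<omega>} \<le> exp (c\<^sup>2 * K\<^sup>2 / 2) / u"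
proof -
  have "emeasure Q {\<omega> \<in> space Q. 1 \<le> ennreal (1 / u) * cell_oscillation c V z \<omega>} \<le>
      ennreal (1 / u) * (\<integral>\<^sup>+ \<omega>. cell_oscillation c V z \<omega> * indicator (space Q) \<omega> \<partial>Q)"
    by (rule nn_integral_Markov_inequality) auto
  also have "(\<integral>\<^sup>+ \<omega>. cell_oscillation c V z \<omega> * indicator (space Q) \<omega> \<partial>Q) =
      (\<integral>\<^sup>+ \<omega>. cell_oscillation c V z \<omega> \<partial>Q)"
    by (intro nn_integral_cong) auto
  also have "ennreal (1 / u) * \<dots> \<le> ennreal (1 / u) * ennreal (exp (c\<^sup>2 * K\<^sup>2 / 2))"
    by (intro mult_left_mono cell_oscillation_moment bound) auto
  also have "\<dots> = ennreal (exp (c\<^sup>2 * K\<^sup>2 / 2) / u)"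
    using u by (simp add: ennreal_mult[symmetric])
  also have "{\<omega> \<in> space Q. 1 \<le> ennreal (1 / u) * cell_oscillation c V z \<omega>} =
      {\<omega> \<in> space Q. ennreal u \<le> cell_oscillation c V z \<omega>}"
  proof -
    have "1 \<le> ennreal (1 / u) * a \<longleftrightarrow> ennreal u \<le> a" for a
      using u by (cases a) (auto simp: ennreal_mult[symmetric] ennreal_mult_top field_simps
          simp flip: ennreal_1)
    then show ?thesis by simp
  qed
  finally show ?thesis
    unfolding emeasure_eq_measure by (rule ennreal_le_iff[THEN iffD1, rotated]) (use u in simp)
qed

lemma prob_increment_le:
  assumes "0 < a"
  shows "prob {\<omega> \<in> space Q. V x \<omega> - V y \<omega> \<le> - u} \<le> exp (a\<^sup>2 * (\<gamma> (x - y))\<^sup>2 / 2 - a * u)"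
proof -
  have "centered_gaussian Q (\<lambda>\<omega>. V x \<omega> - V y \<omega>)"
    using gaussian_process_increment[OF gauss, of 1 x y] by simp
  note mom = centered_gaussian_exp_moment(2,3)[OF prob_space_axioms this, of "- a"]
  have "{\<omega> \<in> space Q. V x \<omega> - V y \<omega> \<le> - u} =
      {\<omega> \<in> space Q. exp (a * u) \<le> exp (- a * (V x \<omega> - V y \<omega>))}"
  proof -
    have "v \<le> - u \<longleftrightarrow> a * u \<le> - a * v" for v
    proof -
      have "v \<le> - u \<longleftrightarrow> a * v \<le> a * (- u)" using assms by (simp only: mult_le_cancel_left_pos)
      then show ?thesis by linarith
    qed
    then show ?thesis by simp
  qed
  also have "prob \<dots> \<le> (LINT \<omega>|Q. exp (- a * (V x \<omega> - V y \<omega>))) / exp (a * u)"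
    by (rule integral_Markov_inequality_measure[where A = "{}"]) (use mom in auto)
  also have "\<dots> = exp (a\<^sup>2 * (\<gamma> (x - y))\<^sup>2 / 2 - a * u)"
    using mom(2) by (simp add: increment_variance exp_diff)
  finally show ?thesis .
qed

text \<open>Polarisation: \<open>2 * a * b = a\<^sup>2 + b\<^sup>2 - (b - a)\<^sup>2\<close>, and all three squares are squares of increments.\<close>

lemma increment_covariance:
  "(LINT \<omega>|Q. (V x \<omega> - V z \<omega>) * (V y \<omega> - V z \<omega>)) =
     ((\<gamma> (x - z))\<^sup>2 + (\<gamma> (y - z))\<^sup>2 - (\<gamma> (y - x))\<^sup>2) / 2"
proof -
  have int: "integrable Q (\<lambda>\<omega>. (V x \<omega> - V y \<omega>)\<^sup>2)" for x y
    using centered_gaussian_exp_moment(1)[OF prob_space_axioms gaussian_process_increment[OF gauss, of 1 x y]]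
    by simp
  have "(V x \<omega> - V z \<omega>) * (V y \<omega> - V z \<omega>) =
      ((V x \<omega> - V z \<omega>)\<^sup>2 + (V y \<omega> - V z \<omega>)\<^sup>2 - (V y \<omega> - V x \<omega>)\<^sup>2) / 2" for \<omega>
    by (simp add: power2_eq_square algebra_simps)
  then have "(LINT \<omega>|Q. (V x \<omega> - V z \<omega>) * (V y \<omega> - V z \<omega>)) =
      (LINT \<omega>|Q. ((V x \<omega> - V z \<omega>)\<^sup>2 + (V y \<omega> - V z \<omega>)\<^sup>2 - (V y \<omega> - V x \<omega>)\<^sup>2) / 2)"
    by (simp only:)
  also have "\<dots> = ((\<gamma> (x - z))\<^sup>2 + (\<gamma> (y - z))\<^sup>2 - (\<gamma> (y - x))\<^sup>2) / 2"
    using int by (simp add: increment_variance)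
  finally show ?thesis .
qed

text \<open>Infinitely often the corner value at \<open>x k\<close> is below \<open>V 0 - \<gamma> (x k) / 2\<close>, a drop of at least cubic order in \<open>k\<close>,
  whereas the oscillation on the cell is eventually below \<open>(k + 1)\<^sup>2\<close> by Markov's inequality and the
  Borel-Cantelli lemma.\<close>

lemma cell_masses_unbounded:
  fixes x :: "nat \<Rightarrow> real ^ 'n"
  assumes bound: "\<And>x. norm x \<le> CARD('n) \<Longrightarrow> 0 \<le> \<gamma> x \<and> \<gamma> x \<le> K"
    and pos: "\<And>k. 0 < \<gamma> (x k)" and large: "\<And>k. real (Suc k) ^ 3 \<le> \<gamma> (x k)"
    and sparse: "\<And>j k. j < k \<Longrightarrow>
      ((\<gamma> (x j))\<^sup>2 + (\<gamma> (x k))\<^sup>2 - (\<gamma> (x k - x j))\<^sup>2) / (2 * \<gamma> (x j) * \<gamma> (x k)) \<le> (1 / 4) ^ k"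
  shows "AE \<omega> in Q. \<forall>M. \<exists>k. ennreal M \<le> emeasure (random_measure V \<omega>) (unit_cell (x k))"
proof -
  define Y where "Y k \<omega> = (V (x k) \<omega> - V 0 \<omega>) / \<gamma> (x k)" for k \<omega>
  have "AE \<omega> in Q. \<exists>\<^sub>\<infinity>k. Y k \<omega> < - 1 / 2"
  proof (rule nearly_orthogonal_gaussians_below_infinitely_often[OF prob_space_axioms])
    show "centered_gaussian Q (\<lambda>\<omega>. a * Y j \<omega> + b * Y k \<omega>)" for j k a b
      using gaussian_process_two_increments[OF gauss, of "a / \<gamma> (x j)" "x j" 0 "b / \<gamma> (x k)" "x k"]
      by (simp add: Y_def)
    show "(LINT \<omega>|Q. (Y k \<omega>)\<^sup>2) = 1" for k
      using increment_variance[of "x k" 0] pos[of k] by (simp add: Y_def power_divide)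
    show "(LINT \<omega>|Q. Y j \<omega> * Y k \<omega>) \<le> (1 / 4) ^ k" if "j < k" for j k
    proof -
      have "(LINT \<omega>|Q. Y j \<omega> * Y k \<omega>) =
          (LINT \<omega>|Q. (V (x j) \<omega> - V 0 \<omega>) * (V (x k) \<omega> - V 0 \<omega>)) / (\<gamma> (x j) * \<gamma> (x k))"
        by (simp add: Y_def)
      then show ?thesis
        using sparse[OF that] by (simp add: increment_covariance mult.assoc)
    qed
  qed
  moreover have "AE \<omega> in Q. eventually (\<lambda>k. \<omega> \<in> space Q -
      {\<omega> \<in> space Q. ennreal (real (Suc k) ^ 2) \<le> cell_oscillation 1 V (x k) \<omega>}) sequentially"
  proof (rule borel_cantelli_AE1)
    have "summable (\<lambda>k. exp (K\<^sup>2 / 2) * (1 / real (Suc k) ^ 2))"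
      using inverse_power_summable[of 2, where 'a = real]
      by (intro summable_mult) (subst summable_Suc_iff, simp add: inverse_eq_divide)
    then show "summable (\<lambda>k. prob {\<omega> \<in> space Q. ennreal (real (Suc k) ^ 2) \<le> cell_oscillation 1 V (x k) \<omega>})"
    proof (rule summable_comparison_test'[where N = 0])
      fix k
      show "norm (prob {\<omega> \<in> space Q. ennreal (real (Suc k) ^ 2) \<le> cell_oscillation 1 V (x k) \<omega>})
          \<le> exp (K\<^sup>2 / 2) * (1 / real (Suc k) ^ 2)"
        using prob_cell_oscillation_ge[OF bound, of "real (Suc k) ^ 2" 1 "x k"] by simp
    qed
  qed (auto simp: emeasure_eq_measure)
  ultimately show ?thesis
  proof eventually_elim
    case (elim \<omega>)
    show ?case
    proof
      fix M :: real
      have "eventually (\<lambda>k. M \<le> real (Suc k) ^ 3 / 2 - V 0 \<omega> - real (Suc k) ^ 2) sequentially"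
        by real_asymp
      with elim(2) have "eventually (\<lambda>k. M \<le> real (Suc k) ^ 3 / 2 - V 0 \<omega> - real (Suc k) ^ 2 \<and>
          \<not> ennreal (real (Suc k) ^ 2) \<le> cell_oscillation 1 V (x k) \<omega>) sequentially"
        by eventually_elim auto
      from elim(1) this have "\<exists>\<^sub>\<infinity>k. Y k \<omega> < - 1 / 2 \<and> M \<le> real (Suc k) ^ 3 / 2 - V 0 \<omega> - real (Suc k) ^ 2 \<and>
          \<not> ennreal (real (Suc k) ^ 2) \<le> cell_oscillation 1 V (x k) \<omega>"
        unfolding cofinite_eq_sequentially[symmetric] by (rule INFM_conjI)
      then obtain k where k: "Y k \<omega> < - 1 / 2" "M \<le> real (Suc k) ^ 3 / 2 - V 0 \<omega> - real (Suc k) ^ 2"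
          "\<not> ennreal (real (Suc k) ^ 2) \<le> cell_oscillation 1 V (x k) \<omega>"
        by (auto dest: INFM_EX)
      have "V (x k) \<omega> - V 0 \<omega> < - \<gamma> (x k) / 2"
        using k(1) pos[of k] by (simp add: Y_def field_simps)
      then have V: "M + real (Suc k) ^ 2 \<le> - V (x k) \<omega>"
        using k(2) large[of k] by simp
      show "\<exists>k. ennreal M \<le> emeasure (random_measure V \<omega>) (unit_cell (x k))"
      proof (cases "M \<le> 0")
        case True
        then show ?thesis by (simp add: ennreal_neg)
      next
        case False
        have "ennreal (real (Suc k) ^ 2) + ennreal M = ennreal (M + real (Suc k) ^ 2)"
          using False by (subst ennreal_plus[symmetric]) (auto simp: add.commute)
        also have "\<dots> \<le> ennreal (- V (x k) \<omega>)"
          using V by (rule ennreal_leI)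
        also have "\<dots> \<le> emeasure (random_measure V \<omega>) (unit_cell (x k)) + cell_oscillation 1 V (x k) \<omega>"
          by (rule le_mass_unit_cell_plus_oscillation) measurable
        also have "\<dots> = cell_oscillation 1 V (x k) \<omega> + emeasure (random_measure V \<omega>) (unit_cell (x k))"
          by (rule add.commute)
        also have "\<dots> \<le> ennreal (real (Suc k) ^ 2) + emeasure (random_measure V \<omega>) (unit_cell (x k))"
          using k(3) by (intro add_right_mono less_imp_le) (simp only: not_le)
        finally have "ennreal M \<le> emeasure (random_measure V \<omega>) (unit_cell (x k))"
          by (simp only: ennreal_add_left_cancel_le ennreal_neq_top infinity_ennreal_def simp_thms)
        then show ?thesis by (rule exI[of _ k])
      qed
    qed
  qed
qed

end

section \<open>Masses of balls\<close>

context continuous_gaussian_field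
begin

text \<open>A lattice point \<open>z\<close> is bad if \<open>exp (V 0 - V z)\<close> or the integral over its cell reaches the threshold
  \<open>exp (n powr ((1 + q) / 2))\<close>.  Each of the \<open>(2 * n + 1)^CARD('n)\<close> points is bad with probability at most a
  constant times \<open>exp (- (n powr ((1 - q) / 2)))\<close>, so the probabilities that some point is bad are summable.\<close>

lemma mass_of_ball_le_exp_powr:
  assumes pos: "\<And>x. 0 \<le> \<gamma> x" and q: "0 < q" "q < 1"
    and growth: "\<And>x r. 1 \<le> r \<Longrightarrow> norm x \<le> r \<Longrightarrow> \<gamma> x \<le> C * r powr q"
  shows "AE \<omega> in Q. \<forall>\<^sub>F n in sequentially.
    emeasure (random_measure V \<omega>) (cball 0 (real n)) \<le>
      ennreal (real (2 * n + 1) ^ CARD('n) * exp (2 * real n powr ((1 + q) / 2) - V 0 \<omega>))"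
proof -
  define d where "d = CARD('n)"
  define p where "p = (1 + q) / 2"
  define K where "K = C * real d powr q"
  have d: "d \<ge> 1" unfolding d_def by (simp add: Suc_leI)
  have near: "0 \<le> \<gamma> x \<and> \<gamma> x \<le> K" if "norm x \<le> CARD('n)" for x
    using pos growth[of "real d" x] that d by (simp add: K_def d_def)
  define E where "E n = exp (real n powr p)" for n
  define A where "A n z = {\<omega> \<in> space Q. V z \<omega> - V 0 \<omega> \<le> - (real n powr p)}" for n z
  define B where "B n z = {\<omega> \<in> space Q. ennreal (E n) \<le> cell_oscillation (- 1) V z \<omega>}" for n z
  define bad where "bad n = (\<Union>z\<in>lattice_cube n. A n z \<union> B n z)" for n
  have [measurable]: "A n z \<in> sets Q" "B n z \<in> sets Q" for n z
    unfolding A_def B_def by measurable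
  have fin: "finite (lattice_cube n :: (real ^ 'n) set)" for n by (rule finite_lattice_cube)
  have [measurable]: "bad n \<in> sets Q" for n
    unfolding bad_def using fin by (intro sets.finite_UN) auto
  have A_le: "prob (A n z) \<le> exp (K\<^sup>2 / 2) * exp (- (real n powr ((1 - q) / 2)))"
    if "z \<in> lattice_cube n" "n \<ge> 1" for n z
  proof -
    \<comment> \<open>The exponential moment of order \<open>n powr (- q)\<close> is bounded, as this is the inverse order of the standard
      deviation; the threshold then gains \<open>n powr ((1 + q) / 2 - q)\<close> in the exponent.\<close>
    define a where "a = real n powr (- q)"
    have a: "0 < a" using that by (simp add: a_def)
    have "\<gamma> z \<le> C * (real d * real n) powr q"
      using that norm_le_of_lattice_cube[OF that(1)] d
      by (intro growth) (auto simp: d_def intro: order_trans[OF _ mult_mono[of 1 _ 1]])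
    also have "\<dots> = K * real n powr q"
      by (simp add: K_def powr_mult)
    finally have "a * \<gamma> z \<le> a * (K * real n powr q)"
      using a by (intro mult_left_mono) auto
    also have "\<dots> = K"
      using that by (simp add: a_def powr_minus field_simps)
    finally have aK: "a\<^sup>2 * (\<gamma> z)\<^sup>2 \<le> K\<^sup>2"
      unfolding power_mult_distrib[symmetric] using a pos[of z] by (intro power_mono) auto
    have exponent: "a * real n powr p = real n powr ((1 - q) / 2)"
      unfolding a_def p_def powr_add[symmetric] by (simp add: field_simps)
    have "prob (A n z) \<le> exp (a\<^sup>2 * (\<gamma> (z - 0))\<^sup>2 / 2 - a * real n powr p)"
      unfolding A_def by (rule prob_increment_le[OF a])
    also have "\<dots> \<le> exp (K\<^sup>2 / 2 + - (real n powr ((1 - q) / 2)))"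
      unfolding exponent exp_le_cancel_iff using aK by simp
    also have "\<dots> = exp (K\<^sup>2 / 2) * exp (- (real n powr ((1 - q) / 2)))"
      by (rule exp_add)
    finally show ?thesis .
  qed
  have B_le: "prob (B n z) \<le> exp (K\<^sup>2 / 2) * exp (- (real n powr ((1 - q) / 2)))"
    if "n \<ge> 1" for n z
  proof -
    have "prob (B n z) \<le> exp ((- 1)\<^sup>2 * K\<^sup>2 / 2) / E n"
      unfolding B_def
    proof (rule prob_cell_oscillation_ge)
      show "0 \<le> \<gamma> x \<and> \<gamma> x \<le> K" if "norm x \<le> CARD('n)" for x
        using near that .
      show "0 < E n" by (simp add: E_def)
    qed
    also have "\<dots> = exp (K\<^sup>2 / 2) * exp (- (real n powr p))"
      unfolding E_def exp_minus divide_inverse by simp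
    also have "real n powr ((1 - q) / 2) \<le> real n powr p"
      using that q by (intro powr_mono) (auto simp: p_def)
    then have "exp (K\<^sup>2 / 2) * exp (- (real n powr p)) \<le> exp (K\<^sup>2 / 2) * exp (- (real n powr ((1 - q) / 2)))"
      by simp
    finally show ?thesis .
  qed
  define b where "b n = (2 * real n + 1) ^ d * (2 * (exp (K\<^sup>2 / 2) * exp (- (real n powr ((1 - q) / 2)))))" for n
  have bad_le: "prob (bad n) \<le> b n" if "n \<ge> 1" for n
  proof -
    have "prob (bad n) \<le> (\<Sum>z\<in>lattice_cube n. prob (A n z \<union> B n z))"
      unfolding bad_def using fin by (intro finite_measure_subadditive_finite) auto
    also have "\<dots> \<le> (\<Sum>z\<in>(lattice_cube n :: (real ^ 'n) set).
        2 * (exp (K\<^sup>2 / 2) * exp (- (real n powr ((1 - q) / 2)))))"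
    proof (rule sum_mono)
      fix z :: "real ^ 'n" assume "z \<in> lattice_cube n"
      then show "prob (A n z \<union> B n z) \<le> 2 * (exp (K\<^sup>2 / 2) * exp (- (real n powr ((1 - q) / 2))))"
        using measure_Un_le[of "A n z" Q "B n z"] A_le[of z n] B_le[of n z] that by simp
    qed
    also have "\<dots> = real (card (lattice_cube n :: (real ^ 'n) set)) *
        (2 * (exp (K\<^sup>2 / 2) * exp (- (real n powr ((1 - q) / 2)))))"
      by simp
    also have "real (card (lattice_cube n :: (real ^ 'n) set)) \<le> real ((2 * n + 1) ^ d)"
      unfolding d_def of_nat_le_iff by (rule card_lattice_cube)
    then have "real (card (lattice_cube n :: (real ^ 'n) set)) *
        (2 * (exp (K\<^sup>2 / 2) * exp (- (real n powr ((1 - q) / 2))))) \<le> b n"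
      unfolding b_def by (intro mult_right_mono) (auto simp: add.commute)
    finally show ?thesis .
  qed
  have "summable b"
  proof (rule summable_comparison_test_bigo)
    show "summable (\<lambda>n. norm (1 / real n ^ 2))"
      using inverse_power_summable[of 2, where 'a = real] by (simp add: inverse_eq_divide)
    show "b \<in> O(\<lambda>n. 1 / real n ^ 2)"
      unfolding b_def using q by real_asymp
  qed
  then have "summable (\<lambda>n. prob (bad n))"
    by (rule summable_comparison_test'[where N = 1]) (use bad_le in auto)
  then have "AE \<omega> in Q. \<forall>\<^sub>F n in sequentially. \<omega> \<in> space Q - bad n"
    by (intro borel_cantelli_AE1) (auto simp: emeasure_eq_measure)
  then show ?thesis
  proof eventually_elim
    case (elim \<omega>)
    then show ?case
    proof eventually_elim
      case (elim n)
      let ?\<mu> = "emeasure (random_measure V \<omega>)"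
      have cell: "?\<mu> (unit_cell z) \<le> ennreal (exp (2 * real n powr p - V 0 \<omega>))"
        if "z \<in> lattice_cube n" for z
      proof -
        have V: "- V z \<omega> \<le> real n powr p - V 0 \<omega>"
          using elim that by (force simp: bad_def A_def)
        have I: "cell_oscillation (- 1) V z \<omega> \<le> ennreal (E n)"
          using elim that by (force simp: bad_def B_def)
        have "?\<mu> (unit_cell z) = ennreal (exp (- V z \<omega>)) * cell_oscillation (- 1) V z \<omega>"
          by (rule mass_unit_cell_eq) measurable
        also have "\<dots> \<le> ennreal (exp (real n powr p - V 0 \<omega>)) * ennreal (E n)"
          using V I by (intro mult_mono ennreal_leI) auto
        also have "\<dots> = ennreal (exp (2 * real n powr p - V 0 \<omega>))"
          by (simp add: E_def ennreal_mult[symmetric] exp_add[symmetric])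
        finally show ?thesis .
      qed
      have "?\<mu> (cball 0 (real n)) \<le> ?\<mu> (\<Union>z\<in>lattice_cube n. unit_cell z)"
        using fin by (intro emeasure_mono cball_subset_lattice_cells)
          (auto simp: random_measure_def intro!: sets.finite_UN)
      also have "\<dots> \<le> (\<Sum>z\<in>lattice_cube n. ?\<mu> (unit_cell z))"
        using fin by (intro emeasure_subadditive_finite) (auto simp: random_measure_def)
      also have "\<dots> \<le> (\<Sum>z\<in>(lattice_cube n :: (real ^ 'n) set). ennreal (exp (2 * real n powr p - V 0 \<omega>)))"
        by (intro sum_mono cell)
      also have "\<dots> = ennreal (real (card (lattice_cube n :: (real ^ 'n) set)) * exp (2 * real n powr p - V 0 \<omega>))"
        by (simp add: ennreal_mult ennreal_of_nat_eq_real_of_nat)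
      also have "\<dots> \<le> ennreal (real ((2 * n + 1) ^ d) * exp (2 * real n powr p - V 0 \<omega>))"
        unfolding d_def using card_lattice_cube[of n, where 'n = 'n]
        by (intro ennreal_leI mult_right_mono of_nat_mono) auto
      finally show ?case by (simp add: p_def d_def)
    qed
  qed
qed

end

text \<open>The bound at integer radii carries over to real \<open>R\<close> by rounding up, with \<open>\<lceil>R\<rceil> \<le> 2 * R\<close> for \<open>R \<ge> 1\<close>.\<close>

lemma log_mass_div_tendsto_0:
  fixes W :: "real ^ 'n \<Rightarrow> 'w \<Rightarrow> real"
  assumes inf: "((\<lambda>R. emeasure (random_measure W \<omega>) (cball 0 R)) \<longlongrightarrow> \<infinity>) at_top"
    and p: "0 < p" "p < 1"
    and upper: "\<forall>\<^sub>F n in sequentially. emeasure (random_measure W \<omega>) (cball 0 (real n)) \<le>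
      ennreal (real (2 * n + 1) ^ d * exp (2 * real n powr p + v))"
  shows "((\<lambda>R. ereal (1 / R) * log_mass W \<omega> R) \<longlongrightarrow> 0) at_top"
proof -
  let ?\<mu> = "\<lambda>R. emeasure (random_measure W \<omega>) (cball 0 R)"
  define H where "H R = real d * ln (4 * R + 1) + (2 * (2 * R) powr p + v)" for R
  from upper obtain N where N: "\<And>n. n \<ge> N \<Longrightarrow>
      ?\<mu> (real n) \<le> ennreal (real (2 * n + 1) ^ d * exp (2 * real n powr p + v))"
    by (auto simp: eventually_sequentially)
  have up: "?\<mu> R \<le> ennreal (exp (H R))" if R: "R \<ge> real N" "R \<ge> 1" for R
  proof -
    define n where "n = nat \<lceil>R\<rceil>"
    have n: "R \<le> real n" "real n \<le> 2 * R" "N \<le> n"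
      using R unfolding n_def by linarith+
    have "?\<mu> R \<le> ?\<mu> (real n)"
      using n by (intro emeasure_mono) (auto simp: random_measure_def)
    also have "\<dots> \<le> ennreal (real (2 * n + 1) ^ d * exp (2 * real n powr p + v))"
      using N n by simp
    also have "\<dots> \<le> ennreal ((4 * R + 1) ^ d * exp (2 * (2 * R) powr p + v))"
      using n R p by (intro ennreal_leI mult_mono power_mono) (auto intro!: powr_mono2)
    also have "(4 * R + 1) ^ d = exp (real d * ln (4 * R + 1))"
      using R by (simp add: exp_of_nat_mult)
    finally show ?thesis by (simp add: H_def exp_add)
  qed
  have "eventually (\<lambda>R. ?\<mu> R > 1) at_top"
    using inf by (rule order_tendstoD) simp
  then have bounds: "eventually (\<lambda>R. 0 \<le> ereal (1 / R) * log_mass W \<omega> R \<and>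
      ereal (1 / R) * log_mass W \<omega> R \<le> ereal (H R / R)) at_top"
    using eventually_ge_at_top[of "real N"] eventually_ge_at_top[of 1]
  proof eventually_elim
    case (elim R)
    have le: "?\<mu> R \<le> ennreal (exp (H R))" using up elim by simp
    then obtain m where m: "?\<mu> R = ennreal m" "0 \<le> m"
      by (cases "?\<mu> R") (auto simp: top_unique)
    have m1: "m > 1" using elim(1) m by (simp add: ennreal_less_iff flip: ennreal_1)
    have "m \<le> exp (H R)" using le m by (simp add: ennreal_le_iff)
    then have "ln m \<le> ln (exp (H R))" using m1 by (subst ln_le_cancel_iff) auto
    then have "ln m \<le> H R" by simp
    moreover have "log_mass W \<omega> R = ereal (ln m)"
      using m m1 by (simp add: log_mass_def Let_def)
    ultimately show ?case
      using m1 elim by (auto simp: divide_right_mono)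
  qed
  have "((\<lambda>R. H R / R) \<longlongrightarrow> 0) at_top"
    unfolding H_def using p by real_asymp
  then have lim: "((\<lambda>R. ereal (H R / R)) \<longlongrightarrow> 0) at_top"
    by (simp add: zero_ereal_def)
  show ?thesis
  proof (rule tendsto_sandwich[OF _ _ tendsto_const lim])
    show "\<forall>\<^sub>F R in at_top. 0 \<le> ereal (1 / R) * log_mass W \<omega> R"
      using bounds by (rule eventually_mono) (rule conjunct1)
    show "\<forall>\<^sub>F R in at_top. ereal (1 / R) * log_mass W \<omega> R \<le> ereal (H R / R)"
      using bounds by (rule eventually_mono) (rule conjunct2)
  qed
qed

lemma mass_tendsto_infinity:
  fixes z :: "nat \<Rightarrow> real ^ 'n"
  assumes "\<forall>M. \<exists>k. ennreal M \<le> emeasure (random_measure W \<omega>) (unit_cell (z k))"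
  shows "((\<lambda>R. emeasure (random_measure W \<omega>) (cball 0 R)) \<longlongrightarrow> \<infinity>) at_top"
proof (rule order_tendstoI)
  fix a :: ennreal assume "a < \<infinity>"
  then obtain b where b: "a = ennreal b" "0 \<le> b" by (cases a) auto
  obtain k where k: "ennreal (b + 1) \<le> emeasure (random_measure W \<omega>) (unit_cell (z k))"
    using assms by blast
  obtain R0 where R0: "unit_cell (z k) \<subseteq> cball 0 R0"
    using bounded_cbox[of "z k" "z k + 1"] by (auto simp: bounded_iff subset_iff)
  show "eventually (\<lambda>R. a < emeasure (random_measure W \<omega>) (cball 0 R)) at_top"
    using eventually_ge_at_top[of R0]
  proof eventually_elim
    case (elim R)
    have "a < ennreal (b + 1)" using b by (simp add: ennreal_less_iff)
    also have "\<dots> \<le> emeasure (random_measure W \<omega>) (unit_cell (z k))" by (fact k)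
    also have "\<dots> \<le> emeasure (random_measure W \<omega>) (cball 0 R)"
      using R0 elim by (intro emeasure_mono) (auto simp: random_measure_def subset_iff)
    finally show ?case .
  qed
qed simp

theorem proposition3p3:
  fixes Q :: "'w measure"
    and W :: "real ^ 'n \<Rightarrow> 'w \<Rightarrow> real"
    and \<gamma> :: "real ^ 'n \<Rightarrow> real"
  assumes gauss: "centered_gaussian_process Q W"
    and cont: "AE \<omega> in Q. continuous_on UNIV (\<lambda>x. W x \<omega>)"
    and env: "gaussian_environment Q W \<gamma>"
  shows "(AE \<omega> in Q. ((\<lambda>R. emeasure (random_measure W \<omega>) (cball 0 R)) \<longlongrightarrow> \<infinity>) at_top) \<and>
    (Limsup at_infinity (\<lambda>x. ereal (\<gamma> x * sqrt (ln (ln (norm x))) / norm x)) < \<infinity> \<longrightarrow>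
       (AE \<omega> in Q. Limsup at_top (\<lambda>R. ereal (1 / R) * log_mass W \<omega> R) < \<infinity>)) \<and>
    ((\<exists>p\<in>{0<..<1}.
        Limsup at_infinity (\<lambda>x. ereal (\<gamma> x * sqrt (ln (ln (norm x))) / norm x powr p)) = 0) \<longrightarrow>
       (AE \<omega> in Q. ((\<lambda>R. ereal (1 / R) * log_mass W \<omega> R) \<longlongrightarrow> 0) at_top))"
proof -
  obtain V where V: "centered_gaussian_process Q V" "\<forall>\<omega>. continuous_on UNIV (\<lambda>x. V x \<omega>)"
    and VW: "AE \<omega> in Q. \<forall>x. V x \<omega> = W x \<omega>"
    by (rule gaussian_process_continuous_version[OF gauss cont])
  have "prob_space Q" using gauss by (simp add: centered_gaussian_process_def)
  then interpret prob_space Q .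
  have \<gamma>0: "\<gamma> 0 = 0" and \<gamma>_pos: "\<And>x. x \<noteq> 0 \<Longrightarrow> 0 < \<gamma> x"
    and var: "\<And>x y. (LINT \<omega>|Q. (W x \<omega> - W y \<omega>)\<^sup>2) = (\<gamma> (x - y))\<^sup>2"
    using env unfolding gaussian_environment_def by (elim conjE; blast)+
  have \<gamma>_nonneg: "0 \<le> \<gamma> x" for x
    using \<gamma>0 \<gamma>_pos[of x] by (cases "x = 0") auto
  have meas: "U x \<in> borel_measurable Q" if "centered_gaussian_process Q U" for U x
    using gaussian_process_linear_combination[OF that, of "{x}" "\<lambda>_. 1"]
    by (simp add: centered_gaussian_def)
  note [measurable] = meas[OF gauss] meas[OF V(1)]
  interpret continuous_gaussian_field Q V \<gamma>
  proof
    fix x y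
    have "(LINT \<omega>|Q. (V x \<omega> - V y \<omega>)\<^sup>2) = (LINT \<omega>|Q. (W x \<omega> - W y \<omega>)\<^sup>2)"
      using VW by (intro integral_cong_AE) auto
    then show "(LINT \<omega>|Q. (V x \<omega> - V y \<omega>)\<^sup>2) = (\<gamma> (x - y))\<^sup>2" by (simp add: var)
  qed (use V in auto)
  obtain C q where Cq: "0 \<le> C" "0 < q" "q < 1"
    and growth: "\<And>x r. 1 \<le> r \<Longrightarrow> norm x \<le> r \<Longrightarrow> \<gamma> x \<le> C * r powr q"
    using gaussian_environment_variance_growth[OF env] by metis
  obtain x :: "nat \<Rightarrow> real ^ 'n" where x: "\<And>k. 0 < \<gamma> (x k)" "\<And>k. real (Suc k) ^ 3 \<le> \<gamma> (x k)"
    "\<And>j k. j < k \<Longrightarrow>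
      ((\<gamma> (x j))\<^sup>2 + (\<gamma> (x k))\<^sup>2 - (\<gamma> (x k - x j))\<^sup>2) / (2 * \<gamma> (x j) * \<gamma> (x k)) \<le> (1 / 4) ^ k"
    using gaussian_environment_sparse_points[OF env, of "\<lambda>k. real (Suc k) ^ 3"] by metis
  have "AE \<omega> in Q. \<forall>M. \<exists>k. ennreal M \<le> emeasure (random_measure V \<omega>) (unit_cell (x k))"
  proof (rule cell_masses_unbounded[OF _ x])
    show "0 \<le> \<gamma> y \<and> \<gamma> y \<le> C * real CARD('n) powr q" if "norm y \<le> CARD('n)" for y
      using \<gamma>_nonneg growth[OF _ that] by (simp add: Suc_leI)
  qed
  then have lim: "AE \<omega> in Q. ((\<lambda>R. emeasure (random_measure V \<omega>) (cball 0 R)) \<longlongrightarrow> \<infinity>) at_top"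
    by eventually_elim (rule mass_tendsto_infinity)
  have upper: "AE \<omega> in Q. \<forall>\<^sub>F n in sequentially.
      emeasure (random_measure V \<omega>) (cball 0 (real n)) \<le>
        ennreal (real (2 * n + 1) ^ CARD('n) * exp (2 * real n powr ((1 + q) / 2) - V 0 \<omega>))"
    by (rule mass_of_ball_le_exp_powr[OF \<gamma>_nonneg Cq(2,3) growth])
  have log_lim: "AE \<omega> in Q. ((\<lambda>R. ereal (1 / R) * log_mass V \<omega> R) \<longlongrightarrow> 0) at_top"
    using lim upper
  proof eventually_elim
    case (elim \<omega>)
    then show ?case
      using Cq by (intro log_mass_div_tendsto_0[of V \<omega> "(1 + q) / 2" "CARD('n)" "- V 0 \<omega>"]) auto
  qed
  have same: "AE \<omega> in Q. random_measure V \<omega> = random_measure W \<omega>"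
    using VW by eventually_elim (simp add: random_measure_def)
  have lim_W: "AE \<omega> in Q. ((\<lambda>R. emeasure (random_measure W \<omega>) (cball 0 R)) \<longlongrightarrow> \<infinity>) at_top"
    using lim same by eventually_elim simp
  have log_lim_W: "AE \<omega> in Q. ((\<lambda>R. ereal (1 / R) * log_mass W \<omega> R) \<longlongrightarrow> 0) at_top"
    using log_lim same by eventually_elim (simp add: log_mass_def)
  have "AE \<omega> in Q. Limsup at_top (\<lambda>R. ereal (1 / R) * log_mass W \<omega> R) < \<infinity>"
    using log_lim_W
  proof eventually_elim
    case (elim \<omega>)
    then have "Limsup at_top (\<lambda>R. ereal (1 / R) * log_mass W \<omega> R) = 0"
      by (intro lim_imp_Limsup) auto
    then show ?case by simp
  qed
  with lim_W log_lim_W show ?thesis by blast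
qed

end
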